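(* Let $A\in\mathbb{H}^{n\times n}$ be a constant quaternion matrix. The system $\dot{\boldsymbol{x}}=A\boldsymbol{x}$ (1) is stable if and only if the standard eigenvalues of $A$ all have non-positive real parts and the algebraic multiplicity equals the geometric multiplicity for each standard eigenvalue with zero real part; (2) is asymptotically stable if and only if all the standard eigenvalues of $A$ have negative real parts.
   Context: $\mathbb{H}$ is the real quaternion algebra with units $\mathbf{i},\mathbf{j},\mathbf{k}$, and $\mathbb{C}=\{a+b\mathbf{i}\}\subset\mathbb{H}$. Eigenvalues. A right eigenvalue of $A\in\mathbb{H}^{n\times n}$ is $\lambda\in\mathbb{H}$ with $A\boldsymbol{\eta}=\boldsymbol{\eta}\lambda$ for some nonzero $\boldsymbol{\eta}\in\mathbb{H}^{n}$. Every $A\in\mathbb{H}^{n\times n}$ has a Jordan canonical form in $\mathbb{C}^{n\times n}$: there is an invertible $P\in\mathbb{H}^{n\times n}$ with $P^{-1}AP=J$, where $J\in\mathbb{C}^{n\times n}$ is a (complex) Jordan matrix all of whose diagonal entries have nonnegative imaginary part. The standard eigenvalues of $A$ are its right eigenvalues that are complex numbers with nonnegative imaginary part; counted with multiplicity there are exactly $n$, and they are the diagonal entries of $J$. The algebraic multiplicity of a standard eigenvalue $\lambda$ is the number of its occurrences on the diagonal of $J$; its geometric multiplicity is the complex dimension of $\{\boldsymbol{x}\in\mathbb{C}^n:(J-\lambda I)\boldsymbol{x}=0\}$. Stability. On $\mathbb{H}^n$ use $\|\boldsymbol{\eta}\|=\sum_k|\eta_k|$. For $\dot{\boldsymbol{x}}=f(t,\boldsymbol{x})$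 on $[t_0,\infty)$, let $\boldsymbol{\phi}(t,t_0,\boldsymbol{x}_0)$ be the solution with $\boldsymbol{x}(t_0)=\boldsymbol{x}_0$. This solution is stable if for every $\epsilon>0$ there is $\delta>0$ such that $\|\boldsymbol{x}-\boldsymbol{x}_0\|<\delta$ implies $\|\boldsymbol{\phi}(t,t_0,\boldsymbol{x})-\boldsymbol{\phi}(t,t_0,\boldsymbol{x}_0)\|<\epsilon$ for all $t\ge t_0$; it is asymptotically stable if there is $\delta>0$ such that $\lim_{t\to\infty}\|\boldsymbol{\phi}(t,t_0,\boldsymbol{x})-\boldsymbol{\phi}(t,t_0,\boldsymbol{x}_0)\|=0$ whenever $\|\boldsymbol{x}-\boldsymbol{x}_0\|<\delta$. A linear homogeneous system is called stable (asymptotically stable) if its zero solution is (equivalently, all its solutions are). *)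

theory Defs
  imports
    Complex_Main
    "Jordan_Normal_Form.Matrix_Kernel"
    "Jordan_Normal_Form.Jordan_Normal_Form"
begin

subsection \<open>The real quaternions\<close>

text \<open>\<open>Quat a b c d\<close> is the quaternion $a + b i + c j + d k$.\<close>

datatype quat = Quat (q_re: real) (q_i: real) (q_j: real) (q_k: real)

lemma quat_eq_iff:
  "p = q \<longleftrightarrow> q_re p = q_re q \<and> q_i p = q_i q \<and> q_j p = q_j q \<and> q_k p = q_k q"
  by (cases p; cases q) auto

instantiation quat :: ab_group_add
begin

definition "0 = Quat 0 0 0 0"
definition "p + q = Quat (q_re p + q_re q) (q_i p + q_i q) (q_j p + q_j q) (q_k p + q_k q)"
definition "p - q = Quat (q_re p - q_re q) (q_i p - q_i q) (q_j p - q_j q) (q_k p - q_k q)"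
definition "- p = Quat (- q_re p) (- q_i p) (- q_j p) (- q_k p)"

instance
  by standard (auto simp: zero_quat_def plus_quat_def minus_quat_def uminus_quat_def)

end

lemma quat_add_sel [simp]:
  "q_re 0 = 0" "q_i 0 = 0" "q_j 0 = 0" "q_k 0 = 0"
  "q_re (p + q) = q_re p + q_re q" "q_i (p + q) = q_i p + q_i q"
  "q_j (p + q) = q_j p + q_j q" "q_k (p + q) = q_k p + q_k q"
  "q_re (p - q) = q_re p - q_re q" "q_i (p - q) = q_i p - q_i q"
  "q_j (p - q) = q_j p - q_j q" "q_k (p - q) = q_k p - q_k q"
  "q_re (- p) = - q_re p" "q_i (- p) = - q_i p" "q_j (- p) = - q_j p" "q_k (- p) = - q_k p"
  by (simp_all add: zero_quat_def plus_quat_def minus_quat_def uminus_quat_def)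

instantiation quat :: ring_1
begin

definition "1 = Quat 1 0 0 0"

definition "p * q = Quat
  (q_re p * q_re q - q_i p * q_i q - q_j p * q_j q - q_k p * q_k q)
  (q_re p * q_i q + q_i p * q_re q + q_j p * q_k q - q_k p * q_j q)
  (q_re p * q_j q - q_i p * q_k q + q_j p * q_re q + q_k p * q_i q)
  (q_re p * q_k q + q_i p * q_j q - q_j p * q_i q + q_k p * q_re q)"

instance
  by standard (auto simp: quat_eq_iff one_quat_def times_quat_def algebra_simps)

end

lemma quat_mult_sel [simp]:
  "q_re 1 = 1" "q_i 1 = 0" "q_j 1 = 0" "q_k 1 = 0"
  "q_re (p * q) = q_re p * q_re q - q_i p * q_i q - q_j p * q_j q - q_k p * q_k q"
  "q_i (p * q) = q_re p * q_i q + q_i p * q_re q + q_j p * q_k q - q_k p * q_j q"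
  "q_j (p * q) = q_re p * q_j q - q_i p * q_k q + q_j p * q_re q + q_k p * q_i q"
  "q_k (p * q) = q_re p * q_k q + q_i p * q_j q - q_j p * q_i q + q_k p * q_re q"
  by (simp_all add: one_quat_def times_quat_def)

lemma quat_units:
  fixes i j k :: quat
  defines "i \<equiv> Quat 0 1 0 0" and "j \<equiv> Quat 0 0 1 0" and "k \<equiv> Quat 0 0 0 1"
  shows "i * i = - 1" "j * j = - 1" "k * k = - 1"
    and "i * j = k" "j * k = i" "k * i = j"
    and "j * i = - k" "k * j = - i" "i * k = - j"
  by (simp_all add: i_def j_def k_def quat_eq_iff)

instantiation quat :: real_algebra_1
begin

definition "scaleR r p = Quat (r * q_re p) (r * q_i p) (r * q_j p) (r * q_k p)"

instance
  by standard (simp_all add: quat_eq_iff scaleR_quat_def algebra_simps)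

end

instantiation quat :: division_ring
begin

text \<open>The inverse is the conjugate divided by the squared norm.\<close>

definition "inverse p =
  Quat (q_re p) (- q_i p) (- q_j p) (- q_k p)
    /\<^sub>R ((q_re p)\<^sup>2 + (q_i p)\<^sup>2 + (q_j p)\<^sup>2 + (q_k p)\<^sup>2)"

definition "(p::quat) div q = p * inverse q"

instance
proof
  fix p q :: quat
  let ?N = "\<lambda>p. (q_re p)\<^sup>2 + (q_i p)\<^sup>2 + (q_j p)\<^sup>2 + (q_k p)\<^sup>2"
  have N0: "?N p = 0 \<longleftrightarrow> p = 0" for p
    by (auto simp: quat_eq_iff add_nonneg_eq_0_iff)
  show "inverse p * p = 1" "p * inverse p = 1" if "p \<noteq> 0"
    using N0[of p] that
    by (simp_all add: quat_eq_iff inverse_quat_def scaleR_quat_def divide_simps)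
       (simp_all add: power2_eq_square algebra_simps)
  show "inverse (0::quat) = 0"
    by (simp add: quat_eq_iff inverse_quat_def scaleR_quat_def)
  show "p div q = p * inverse q"
    by (simp add: divide_quat_def)
qed

end

instantiation quat :: real_normed_div_algebra
begin

definition "norm p = sqrt ((q_re p)\<^sup>2 + (q_i p)\<^sup>2 + (q_j p)\<^sup>2 + (q_k p)\<^sup>2)"

definition "sgn (p::quat) = p /\<^sub>R norm p"

definition "dist (p::quat) q = norm (p - q)"

definition "(uniformity :: (quat \<times> quat) filter) = (INF e\<in>{0<..}. principal {(p, q). dist p q < e})"

definition "open (U :: quat set) \<longleftrightarrow> (\<forall>p\<in>U. eventually (\<lambda>(p', q). p' = p \<longrightarrow> q \<in> U) uniformity)"

instance
proof
  fix p q :: quat and r :: real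
  let ?N = "\<lambda>p. (q_re p)\<^sup>2 + (q_i p)\<^sup>2 + (q_j p)\<^sup>2 + (q_k p)\<^sup>2"
  have N0: "?N p = 0 \<longleftrightarrow> p = 0" for p
    by (auto simp: quat_eq_iff add_nonneg_eq_0_iff)
  show "sgn p = p /\<^sub>R norm p" "dist p q = norm (p - q)"
    by (simp_all add: sgn_quat_def dist_quat_def)
  show "uniformity = (INF e\<in>{0<..}. principal {(p, q::quat). dist p q < e})"
    by (rule uniformity_quat_def)
  show "open U \<longleftrightarrow> (\<forall>p\<in>U. eventually (\<lambda>(p', q). p' = p \<longrightarrow> q \<in> U) uniformity)"
    for U :: "quat set"
    by (rule open_quat_def)
  show "norm p = 0 \<longleftrightarrow> p = 0"
    using N0[of p] by (simp add: norm_quat_def)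
  have norm_alt: "norm p = sqrt ((sqrt ((q_re p)\<^sup>2 + (q_i p)\<^sup>2))\<^sup>2 + (sqrt ((q_j p)\<^sup>2 + (q_k p)\<^sup>2))\<^sup>2)"
    for p :: quat
    by (simp add: norm_quat_def)
  have "norm (p + q) \<le> sqrt ((sqrt ((q_re p)\<^sup>2 + (q_i p)\<^sup>2) + sqrt ((q_re q)\<^sup>2 + (q_i q)\<^sup>2))\<^sup>2
      + (sqrt ((q_j p)\<^sup>2 + (q_k p)\<^sup>2) + sqrt ((q_j q)\<^sup>2 + (q_k q)\<^sup>2))\<^sup>2)"
    unfolding norm_alt quat_add_sel
    by (intro real_sqrt_le_mono add_mono power_mono real_sqrt_sum_squares_triangle_ineq) auto
  also have "\<dots> \<le> norm p + norm q"
    unfolding norm_alt by (rule real_sqrt_sum_squares_triangle_ineq)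
  finally show "norm (p + q) \<le> norm p + norm q" .
  have "?N (r *\<^sub>R p) = r\<^sup>2 * ?N p"
    by (simp add: scaleR_quat_def power_mult_distrib algebra_simps)
  then show "norm (r *\<^sub>R p) = \<bar>r\<bar> * norm p"
    by (simp add: norm_quat_def real_sqrt_mult)
  have "?N (p * q) = ?N p * ?N q"
    by (simp add: power2_eq_square algebra_simps)
  then show "norm (p * q) = norm p * norm q"
    by (simp add: norm_quat_def real_sqrt_mult)
qed

end

definition quat_of_complex :: "complex \<Rightarrow> quat" where
  "quat_of_complex z = Quat (Re z) (Im z) 0 0"


subsection \<open>Right and standard eigenvalues\<close>

text \<open>The eigenvalue acts on the right, whereas the library's \<open>\<cdot>\<^sub>v\<close> multiplies on the left.\<close>

definition right_eigenvalue :: "quat mat \<Rightarrow> quat \<Rightarrow> bool" where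
  "right_eigenvalue A q \<longleftrightarrow>
    (\<exists>\<eta>\<in>carrier_vec (dim_row A). \<eta> \<noteq> 0\<^sub>v (dim_row A) \<and> A *\<^sub>v \<eta> = map_vec (\<lambda>x. x * q) \<eta>)"

definition standard_eigenvalue :: "quat mat \<Rightarrow> complex \<Rightarrow> bool" where
  "standard_eigenvalue A \<mu> \<longleftrightarrow> right_eigenvalue A (quat_of_complex \<mu>) \<and> 0 \<le> Im \<mu>"


subsection \<open>Jordan form and multiplicities\<close>

definition is_jordan_form :: "quat mat \<Rightarrow> complex mat \<Rightarrow> bool" where
  "is_jordan_form A J \<longleftrightarrow>
    (\<exists>n_as. 0 \<notin> fst ` set n_as \<and> J = jordan_matrix n_as) \<and>
    (\<forall>i<dim_row J. 0 \<le> Im (J $$ (i, i))) \<and>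
    similar_mat A (map_mat quat_of_complex J)"

text \<open>
  Every square quaternion matrix has such a form, unique up to the order of the Jordan
  blocks, so the two multiplicities below do not depend on the choice made here.
\<close>

definition jordan_form :: "quat mat \<Rightarrow> complex mat" where
  "jordan_form A = (SOME J. is_jordan_form A J)"

definition algebraic_multiplicity :: "quat mat \<Rightarrow> complex \<Rightarrow> nat" where
  "algebraic_multiplicity A \<mu> =
    card {i. i < dim_row (jordan_form A) \<and> jordan_form A $$ (i, i) = \<mu>}"

text \<open>\<open>char_matrix J \<mu>\<close> is $J - \mu I$.\<close>

definition geometric_multiplicity :: "quat mat \<Rightarrow> complex \<Rightarrow> nat" where
  "geometric_multiplicity A \<mu> = kernel_dim (char_matrix (jordan_form A) \<mu>)"


subsection \<open>Differential equations and stability\<close>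

definition qvec_norm :: "quat vec \<Rightarrow> real" where
  "qvec_norm \<eta> = (\<Sum>k<dim_vec \<eta>. norm (\<eta> $ k))"

text \<open>
  \<open>x\<close> solves $\dot x = f(t, x)$ on $[t_0, \infty)$ with $x(t_0) = x_0$. The dimension of the
  system is that of \<open>x0\<close>; derivatives are taken componentwise (one-sided at \<open>t0\<close>).
\<close>

definition is_solution ::
  "(real \<Rightarrow> quat vec \<Rightarrow> quat vec) \<Rightarrow> real \<Rightarrow> quat vec \<Rightarrow> (real \<Rightarrow> quat vec) \<Rightarrow> bool" where
  "is_solution f t0 x0 x \<longleftrightarrow>
    x t0 = x0 \<and>
    (\<forall>t\<ge>t0. x t \<in> carrier_vec (dim_vec x0) \<and>
      (\<forall>k<dim_vec x0.
        ((\<lambda>s. x s $ k) has_vector_derivative f t (x t) $ k) (at t within {t0..})))"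

text \<open>
  \<open>flow f t t0 x0\<close> is $\phi(t, t_0, x_0)$. It is meaningful for \<open>t \<ge> t0\<close> and for systems whose
  initial value problems are uniquely solvable on $[t_0, \infty)$, as linear ones are.
\<close>

definition flow :: "(real \<Rightarrow> quat vec \<Rightarrow> quat vec) \<Rightarrow> real \<Rightarrow> real \<Rightarrow> quat vec \<Rightarrow> quat vec" where
  "flow f t t0 x0 = (SOME x. is_solution f t0 x0 x) t"

definition stable_solution ::
  "(real \<Rightarrow> quat vec \<Rightarrow> quat vec) \<Rightarrow> real \<Rightarrow> quat vec \<Rightarrow> bool" where
  "stable_solution f t0 x0 \<longleftrightarrow>
    (\<forall>\<epsilon>>0. \<exists>\<delta>>0. \<forall>x\<in>carrier_vec (dim_vec x0). qvec_norm (x - x0) < \<delta> \<longrightarrow>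
      (\<forall>t\<ge>t0. qvec_norm (flow f t t0 x - flow f t t0 x0) < \<epsilon>))"

definition asymptotically_stable_solution ::
  "(real \<Rightarrow> quat vec \<Rightarrow> quat vec) \<Rightarrow> real \<Rightarrow> quat vec \<Rightarrow> bool" where
  "asymptotically_stable_solution f t0 x0 \<longleftrightarrow>
    (\<exists>\<delta>>0. \<forall>x\<in>carrier_vec (dim_vec x0). qvec_norm (x - x0) < \<delta> \<longrightarrow>
      ((\<lambda>t. qvec_norm (flow f t t0 x - flow f t t0 x0)) \<longlongrightarrow> 0) at_top)"

text \<open>A linear system is called (asymptotically) stable if its zero solution is.\<close>

definition linear_system_stable :: "quat mat \<Rightarrow> real \<Rightarrow> bool" where
  "linear_system_stable A t0 \<longleftrightarrow>
    stable_solution (\<lambda>t x. A *\<^sub>v x) t0 (0\<^sub>v (dim_row A))"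

definition linear_system_asymptotically_stable :: "quat mat \<Rightarrow> real \<Rightarrow> bool" where
  "linear_system_asymptotically_stable A t0 \<longleftrightarrow>
    asymptotically_stable_solution (\<lambda>t x. A *\<^sub>v x) t0 (0\<^sub>v (dim_row A))"

end

theory Submission
  imports
    Defs
    "Jordan_Normal_Form.Spectral_Radius"
    "Jordan_Normal_Form.Jordan_Normal_Form_Uniqueness"
begin

text \<open>
  The solution of \<open>x' = A x\<close> starting at \<open>x0\<close> is $e^{(t - t_0) A} x_0$. If $A = P J P^{-1}$ with
  a complex Jordan matrix $J$, then $e^{tA} = P e^{tJ} P^{-1}$, so the entries of $e^{tA}$ and of
  $e^{tJ}$ are quaternionic linear combinations of one another: one family is bounded, or tends to
  zero, iff the other one does. By linearity, stability says that the entries of $e^{tA}$ are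
  bounded for $t \ge 0$, and asymptotic stability says that they tend to zero
  (\<open>stable_iff_fundamental_bounded\<close>, \<open>asymptotically_stable_iff_fundamental_tendsto_zero\<close>).
  The entries of $e^{tJ}$ are explicit: inside a block with eigenvalue $\mu$ they are
  $t^m / m! \cdot e^{\mu t}$, where $m$ runs up to the block size minus one. They tend to zero iff
  all real parts are negative, and they are bounded iff no real part is positive and every block
  with an eigenvalue of real part zero has size one (\<open>jordan_exp_tendsto_zero_iff\<close>,
  \<open>jordan_exp_bounded_iff\<close>). Finally, the standard eigenvalues of $A$ are exactly the diagonal
  entries of $J$ (\<open>standard_eigenvalue_iff_diagonal\<close>), and all blocks of $\mu$ have size one iff the
  two multiplicities of $\mu$ agree (\<open>multiplicities_eq_iff\<close>).

  The algebraic core is the existence of $J$ (\<open>quaternion_jordan_form_exists\<close>), proved by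
  induction on the dimension. Splitting off a right eigenvector with standard eigenvalue $\mu$
  and putting the complementary block into Jordan form leaves a matrix that is complex except for
  its first row. That row can be made complex by a similarity that keeps the rest
  (\<open>row_elimination\<close>): where the eigenvalue $d$ of a Jordan block satisfies $\mu \ne \bar d$, the
  part of the row in $\mathbb{C} j$ is removed by solving $\mu y - y \bar d = v$ along the block;
  otherwise $\mu = d$ is real, hence central, and a shear followed by a scaling of the block turns
  its part of the row into $(1, 0, \dots, 0)$ or zero. The resulting matrix is complex, so its
  complex Jordan form is available, and conjugation by $j$ replaces the eigenvalues of
  that form with negative imaginary part by their conjugates.
\<close>

section \<open>Complex numbers inside the quaternions\<close>

lemma quat_of_complex_sel [simp]:
  "q_re (quat_of_complex z) = Re z" "q_i (quat_of_complex z) = Im z"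
  "q_j (quat_of_complex z) = 0" "q_k (quat_of_complex z) = 0"
  by (simp_all add: quat_of_complex_def)

interpretation qc: semiring_hom quat_of_complex
  by standard (auto simp: quat_eq_iff)

lemma quat_of_complex_eq_iff [simp]: "quat_of_complex a = quat_of_complex b \<longleftrightarrow> a = b"
  by (auto simp: quat_eq_iff complex_eq_iff)

lemma norm_quat_of_complex [simp]: "norm (quat_of_complex z) = norm z"
  by (simp add: norm_quat_def cmod_def)

lemma quat_scaleR_sel [simp]:
  "q_re (r *\<^sub>R p) = r * q_re p" "q_i (r *\<^sub>R p) = r * q_i p"
  "q_j (r *\<^sub>R p) = r * q_j p" "q_k (r *\<^sub>R p) = r * q_k p"
  by (simp_all add: scaleR_quat_def)

lemma bounded_linear_quat_of_complex: "bounded_linear quat_of_complex"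
  by (rule bounded_linear_intro[where K = 1]) (auto simp: quat_eq_iff)

definition quat_j :: quat where
  "quat_j = Quat 0 0 1 0"

lemma quat_j_sel [simp]: "q_re quat_j = 0" "q_i quat_j = 0" "q_j quat_j = 1" "q_k quat_j = 0"
  by (simp_all add: quat_j_def)

lemma quat_j_nonzero [simp]: "quat_j \<noteq> 0"
  by (simp add: quat_eq_iff)

lemma quat_of_complex_quat_j: "quat_of_complex z * quat_j = quat_j * quat_of_complex (cnj z)"
  by (simp add: quat_eq_iff)

lemma quat_split: "\<exists>a b. q = quat_of_complex a + quat_of_complex b * quat_j"
  by (rule exI[of _ "Complex (q_re q) (q_i q)"], rule exI[of _ "Complex (q_j q) (q_k q)"])
    (simp add: quat_eq_iff)

text \<open>
  Writing $q = u + v j$ with complex $u$ and $v$, the equation $a q = q b$ separates into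
  $(a - b) u = 0$ and $(a - \bar b) v = 0$. So similar complex numbers are equal or conjugate,
  and the upper half plane contains only one of each conjugate pair.
\<close>

lemma similar_upper_half_plane_eq:
  assumes eq: "quat_of_complex a * q = q * quat_of_complex b" and "q \<noteq> 0"
    and im: "0 \<le> Im a" "0 \<le> Im b"
  shows "a = b"
proof -
  define u v where "u = Complex (q_re q) (q_i q)" and "v = Complex (q_j q) (q_k q)"
  have "(a - b) * u = 0" "(a - cnj b) * v = 0"
    using eq by (auto simp: quat_eq_iff u_def v_def complex_eq_iff algebra_simps)
  moreover have "u \<noteq> 0 \<or> v \<noteq> 0"
    using \<open>q \<noteq> 0\<close> by (auto simp: u_def v_def quat_eq_iff complex_eq_iff)
  ultimately have "a = b \<or> a = cnj b"
    by auto
  then show ?thesis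
    using im by (auto simp: complex_eq_iff)
qed

section \<open>Right eigenvectors\<close>

text \<open>
  \<open>quat_fst q\<close> and \<open>quat_snd q\<close> are the complex numbers $u$ and $w$ with $q = u + j w$. The unit $j$
  stands on the left here, so that right multiplication by a complex number acts on $u$ and $w$
  separately.
\<close>

definition quat_fst :: "quat \<Rightarrow> complex" where
  "quat_fst q = Complex (q_re q) (q_i q)"

definition quat_snd :: "quat \<Rightarrow> complex" where
  "quat_snd q = Complex (q_j q) (- q_k q)"

lemma quat_fst_snd_eqI: "quat_fst p = quat_fst q \<Longrightarrow> quat_snd p = quat_snd q \<Longrightarrow> p = q"
  by (auto simp: quat_fst_def quat_snd_def quat_eq_iff)

lemma quat_fst_snd_sum:
  "quat_fst (\<Sum>k\<in>S. f k) = (\<Sum>k\<in>S. quat_fst (f k))"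
  "quat_snd (\<Sum>k\<in>S. f k) = (\<Sum>k\<in>S. quat_snd (f k))"
proof -
  have "quat_fst 0 = 0" "quat_snd 0 = 0"
    "quat_fst (p + q) = quat_fst p + quat_fst q" "quat_snd (p + q) = quat_snd p + quat_snd q" for p q
    by (auto simp: quat_fst_def quat_snd_def complex_eq_iff)
  then show "quat_fst (\<Sum>k\<in>S. f k) = (\<Sum>k\<in>S. quat_fst (f k))"
    "quat_snd (\<Sum>k\<in>S. f k) = (\<Sum>k\<in>S. quat_snd (f k))"
    by (induction S rule: infinite_finite_induct) auto
qed

lemma quat_fst_snd_mult:
  "quat_fst (p * q) = quat_fst p * quat_fst q - cnj (quat_snd p) * quat_snd q"
  "quat_snd (p * q) = quat_snd p * quat_fst q + cnj (quat_fst p) * quat_snd q"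
  by (simp_all add: quat_fst_def quat_snd_def complex_eq_iff)

lemma quat_fst_snd_of_complex [simp]:
  "quat_fst (quat_of_complex z) = z" "quat_snd (quat_of_complex z) = 0"
  by (simp_all add: quat_fst_def quat_snd_def complex_eq_iff)

text \<open>
  In the coordinates $\eta = x + j y$, the map $\eta \mapsto A \eta$ is complex linear on
  $\mathbb{C}^{2n}$ and multiplication of $\eta$ by $\mu$ from the right is scaling by $\mu$. A complex
  eigenvector of this map is therefore a right eigenvector of \<open>A\<close>.
\<close>

lemma right_eigenvalue_exists:
  assumes A: "A \<in> carrier_mat n n" and n: "n > 0"
  shows "\<exists>\<mu>. right_eigenvalue A (quat_of_complex \<mu>)"
proof -
  define U where "U = map_mat quat_fst A"
  define W where "W = map_mat quat_snd A"
  define M where "M = four_block_mat U (- map_mat cnj W) W (map_mat cnj U)"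
  have UW: "U \<in> carrier_mat n n" "- map_mat cnj W \<in> carrier_mat n n"
    "W \<in> carrier_mat n n" "map_mat cnj U \<in> carrier_mat n n"
    using A by (auto simp: U_def W_def)
  have M: "M \<in> carrier_mat (n + n) (n + n)"
    using UW unfolding M_def by simp
  from spectrum_non_empty[OF M] n obtain \<mu> v where ev: "eigenvector M v \<mu>"
    by (auto simp: spectrum_def eigenvalue_def)
  have v: "v \<in> carrier_vec (n + n)" "v \<noteq> 0\<^sub>v (n + n)" "M *\<^sub>v v = \<mu> \<cdot>\<^sub>v v"
    using ev M by (auto simp: eigenvector_def)
  define x where "x = vec_first v n"
  define y where "y = vec_last v n"
  have xy: "x \<in> carrier_vec n" "y \<in> carrier_vec n" and vxy: "v = x @\<^sub>v y"
    using v(1) by (auto simp: x_def y_def)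
  have "(U *\<^sub>v x + - map_mat cnj W *\<^sub>v y) @\<^sub>v (W *\<^sub>v x + map_mat cnj U *\<^sub>v y) = \<mu> \<cdot>\<^sub>v (x @\<^sub>v y)"
    using v(3) unfolding M_def vxy four_block_mat_mult_vec[OF UW xy] .
  also have "\<mu> \<cdot>\<^sub>v (x @\<^sub>v y) = (\<mu> \<cdot>\<^sub>v x) @\<^sub>v (\<mu> \<cdot>\<^sub>v y)"
    using xy by (intro eq_vecI) auto
  finally have eqs: "U *\<^sub>v x + - map_mat cnj W *\<^sub>v y = \<mu> \<cdot>\<^sub>v x"
      "W *\<^sub>v x + map_mat cnj U *\<^sub>v y = \<mu> \<cdot>\<^sub>v y"
    using UW xy by (subst (asm) append_vec_eq[where n = n]; auto)+
  define \<eta> where "\<eta> = vec n (\<lambda>i. quat_of_complex (x $ i) + quat_j * quat_of_complex (y $ i))"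
  have \<eta>_parts: "quat_fst (\<eta> $ i) = x $ i" "quat_snd (\<eta> $ i) = y $ i" if "i < n" for i
    using that by (simp_all add: \<eta>_def quat_fst_def quat_snd_def complex_eq_iff)
  have \<eta>: "\<eta> \<in> carrier_vec n"
    by (simp add: \<eta>_def)
  have "A *\<^sub>v \<eta> = map_vec (\<lambda>q. q * quat_of_complex \<mu>) \<eta>"
  proof (rule eq_vecI)
    fix i assume "i < dim_vec (map_vec (\<lambda>q. q * quat_of_complex \<mu>) \<eta>)"
    then have i: "i < n" using \<eta> by simp
    have Ai: "(A *\<^sub>v \<eta>) $ i = (\<Sum>k<n. A $$ (i,k) * \<eta> $ k)"
      using A \<eta> i by (simp add: scalar_prod_def atLeast0LessThan)
    have "quat_fst ((A *\<^sub>v \<eta>) $ i) = (U *\<^sub>v x + - map_mat cnj W *\<^sub>v y) $ i"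
      unfolding Ai using A i xy
      by (simp add: quat_fst_snd_sum quat_fst_snd_mult \<eta>_parts U_def W_def scalar_prod_def
          atLeast0LessThan sum_subtractf sum_negf)
    moreover have "quat_snd ((A *\<^sub>v \<eta>) $ i) = (W *\<^sub>v x + map_mat cnj U *\<^sub>v y) $ i"
      unfolding Ai using A i xy
      by (simp add: quat_fst_snd_sum quat_fst_snd_mult \<eta>_parts U_def W_def scalar_prod_def
          atLeast0LessThan sum.distrib)
    ultimately show "(A *\<^sub>v \<eta>) $ i = map_vec (\<lambda>q. q * quat_of_complex \<mu>) \<eta> $ i"
      unfolding eqs using i xy \<eta>
      by (intro quat_fst_snd_eqI) (simp_all add: quat_fst_snd_mult \<eta>_parts mult.commute)
  qed (use A \<eta> in auto)
  moreover have "\<eta> \<noteq> 0\<^sub>v n"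
  proof
    assume 0: "\<eta> = 0\<^sub>v n"
    have "x $ i = 0 \<and> y $ i = 0" if "i < n" for i
      using \<eta>_parts[OF that] that unfolding 0 by (simp add: quat_fst_def quat_snd_def complex_eq_iff)
    then have "v = 0\<^sub>v (n + n)"
      unfolding vxy using xy by (intro eq_vecI) auto
    with v(2) show False by simp
  qed
  ultimately show ?thesis
    using A \<eta> unfolding right_eigenvalue_def by auto
qed

text \<open>
  Replacing $\eta$ by $\eta j$ conjugates the eigenvalue, because $\mu j = j \bar\mu$.
\<close>

lemma standard_eigenvalue_exists:
  assumes A: "A \<in> carrier_mat n n" and n: "n > 0"
  shows "\<exists>\<mu>. standard_eigenvalue A \<mu>"
proof -
  obtain \<mu> where \<mu>: "right_eigenvalue A (quat_of_complex \<mu>)"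
    using right_eigenvalue_exists[OF A n] by blast
  show ?thesis
  proof (cases "0 \<le> Im \<mu>")
    case True
    with \<mu> show ?thesis by (auto simp: standard_eigenvalue_def)
  next
    case False
    obtain \<eta> where \<eta>: "\<eta> \<in> carrier_vec n" "\<eta> \<noteq> 0\<^sub>v n"
      and ev: "A *\<^sub>v \<eta> = map_vec (\<lambda>x. x * quat_of_complex \<mu>) \<eta>"
      using \<mu> A by (auto simp: right_eigenvalue_def)
    let ?\<eta>j = "map_vec (\<lambda>x. x * quat_j) \<eta>"
    have "A *\<^sub>v ?\<eta>j = map_vec (\<lambda>x. x * quat_j) (A *\<^sub>v \<eta>)"
      using A \<eta> by (intro eq_vecI) (auto simp: scalar_prod_def sum_distrib_right mult.assoc)
    also have "\<dots> = map_vec (\<lambda>x. x * quat_of_complex (cnj \<mu>)) ?\<eta>j"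
      unfolding ev by (intro eq_vecI) (auto simp: mult.assoc quat_of_complex_quat_j)
    finally have "A *\<^sub>v ?\<eta>j = map_vec (\<lambda>x. x * quat_of_complex (cnj \<mu>)) ?\<eta>j" .
    moreover have "?\<eta>j \<noteq> 0\<^sub>v n"
      using \<eta> by (auto simp: vec_eq_iff)
    moreover have "?\<eta>j \<in> carrier_vec n"
      using \<eta>(1) by simp
    ultimately have "right_eigenvalue A (quat_of_complex (cnj \<mu>))"
      using A unfolding right_eigenvalue_def by auto
    then show ?thesis
      using False by (auto simp: standard_eigenvalue_def intro: exI[of _ "cnj \<mu>"])
  qed
qed

section \<open>The shape of a Jordan matrix\<close>

text \<open>
  The features of a Jordan matrix on which the later arguments rely, in terms of single entries.
  Two neighbouring indices belong to the same block iff the superdiagonal entry between them is one,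
  so that no explicit list of blocks is needed.
\<close>

definition jordan_bidiagonal :: "complex mat \<Rightarrow> bool" where
  "jordan_bidiagonal J \<longleftrightarrow> dim_col J = dim_row J \<and>
    (\<forall>i<dim_row J. \<forall>k<dim_row J. k \<noteq> i \<longrightarrow> k \<noteq> Suc i \<longrightarrow> J $$ (i,k) = 0) \<and>
    (\<forall>i. Suc i < dim_row J \<longrightarrow> J $$ (i, Suc i) = 0 \<or>
      J $$ (i, Suc i) = 1 \<and> J $$ (Suc i, Suc i) = J $$ (i,i))"

lemma jordan_matrix_Cons_index:
  assumes "i < m + sum_list (map fst n_as)" "k < m + sum_list (map fst n_as)"
  shows "jordan_matrix ((m,a) # n_as) $$ (i,k) =
    (if i < m then (if k < m then (if i = k then a else if Suc i = k then 1 else 0) else 0)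
     else if k < m then 0 else jordan_matrix n_as $$ (i - m, k - m))"
  using assms by (auto simp: jordan_matrix_Cons)

lemma jordan_bidiagonal_jordan_matrix: "jordan_bidiagonal (jordan_matrix n_as)"
proof (induction n_as)
  case Nil
  show ?case by (simp add: jordan_bidiagonal_def)
next
  case (Cons p n_as)
  obtain m a where p: "p = (m,a)" by force
  let ?N = "sum_list (map fst n_as)"
  have IH1: "jordan_matrix n_as $$ (i,k) = 0" if "i < ?N" "k < ?N" "k \<noteq> i" "k \<noteq> Suc i" for i k
    using Cons that by (auto simp: jordan_bidiagonal_def)
  have IH2: "jordan_matrix n_as $$ (i, Suc i) = 0 \<or> jordan_matrix n_as $$ (i, Suc i) = 1 \<and>
      jordan_matrix n_as $$ (Suc i, Suc i) = jordan_matrix n_as $$ (i,i)" if "Suc i < ?N" for i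
    using Cons that by (auto simp: jordan_bidiagonal_def)
  have IH2': "jordan_matrix n_as $$ (i - m, Suc i - m) = 0 \<or>
      jordan_matrix n_as $$ (i - m, Suc i - m) = 1 \<and>
      jordan_matrix n_as $$ (Suc i - m, Suc i - m) = jordan_matrix n_as $$ (i - m,i - m)"
    if "Suc i < m + ?N" "m \<le> i" for i
    using IH2[of "i - m"] that by (simp add: Suc_diff_le)
  show ?case
    unfolding jordan_bidiagonal_def p
    using IH2' by (auto simp: jordan_matrix_Cons_index intro!: IH1)
qed

lemma jordan_matrix_map_eigenvalues_index:
  assumes "i < sum_list (map fst n_as)" "k < sum_list (map fst n_as)"
  shows "jordan_matrix (map (\<lambda>(m,a). (m, f a)) n_as) $$ (i,k) =
    (if i = k then f (jordan_matrix n_as $$ (i,i)) else jordan_matrix n_as $$ (i,k))"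
  using assms
proof (induction n_as arbitrary: i k)
  case (Cons p n_as)
  obtain m a where p: "p = (m,a)" by force
  have [simp]: "sum_list (map (fst \<circ> (\<lambda>(m, a). (m, f a))) n_as) = sum_list (map fst n_as)"
    by (rule arg_cong[where f = sum_list]) auto
  show ?case
    using Cons by (auto simp: p jordan_matrix_Cons_index)
qed simp

section \<open>Similarity of quaternion matrices\<close>

lemma similar_mat_intertwine:
  assumes carr: "A \<in> carrier_mat n n" "B \<in> carrier_mat n n" "T \<in> carrier_mat n n" "T' \<in> carrier_mat n n"
    and inv: "T * T' = 1\<^sub>m n" "T' * T = 1\<^sub>m n"
    and AT: "A * T = T * B"
  shows "similar_mat A B"
proof (rule similar_matI)
  have "A = A * (T * T')"
    using carr inv by simp
  also have "\<dots> = A * T * T'"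
    using carr by (intro assoc_mult_mat[symmetric]) auto
  finally show "A = T * B * T'"
    by (simp add: AT)
qed (use carr inv in auto)

lemma diagonal_mat_inverse:
  fixes e :: "nat \<Rightarrow> 'a :: division_ring"
  assumes "\<And>i. i < n \<Longrightarrow> e i \<noteq> 0"
  shows "mat n n (\<lambda>(i,k). if i = k then e i else 0) * mat n n (\<lambda>(i,k). if i = k then inverse (e i) else 0) = 1\<^sub>m n"
    and "mat n n (\<lambda>(i,k). if i = k then inverse (e i) else 0) * mat n n (\<lambda>(i,k). if i = k then e i else 0) = 1\<^sub>m n"
  using assms
  by (auto intro!: eq_matI simp: scalar_prod_def if_distrib[of "\<lambda>x. x * _"] if_distrib[of "(*) _"] sum.delta' sum.delta
      cong: if_cong)

lemma mult_diagonal_mat_index: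
  fixes e :: "nat \<Rightarrow> 'a :: division_ring"
  assumes "B \<in> carrier_mat r n" "i < r" "k < n"
  shows "(B * mat n n (\<lambda>(i,k). if i = k then e i else 0)) $$ (i,k) = B $$ (i,k) * e k"
  using assms by (auto simp: scalar_prod_def if_distrib[of "(*) _"] cong: if_cong)

lemma diagonal_mat_mult_index:
  fixes e :: "nat \<Rightarrow> 'a :: division_ring"
  assumes "B \<in> carrier_mat n c" "i < n" "k < c"
  shows "(mat n n (\<lambda>(i,k). if i = k then e i else 0) * B) $$ (i,k) = e i * B $$ (i,k)"
  using assms by (auto simp: scalar_prod_def if_distrib[of "\<lambda>x. x * _"] cong: if_cong)

lemma similar_mat_diagonal:
  fixes e :: "nat \<Rightarrow> 'a :: division_ring"
  assumes carr: "A \<in> carrier_mat n n" "B \<in> carrier_mat n n"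
    and "\<And>i. i < n \<Longrightarrow> e i \<noteq> 0"
    and "\<And>i k. i < n \<Longrightarrow> k < n \<Longrightarrow> A $$ (i,k) * e k = e i * B $$ (i,k)"
  shows "similar_mat A B"
proof -
  let ?T = "mat n n (\<lambda>(i,k). if i = k then e i else 0)"
  let ?T' = "mat n n (\<lambda>(i,k). if i = k then inverse (e i) else 0)"
  have "A * ?T = ?T * B"
  proof (rule eq_matI)
    fix i k assume "i < dim_row (?T * B)" "k < dim_col (?T * B)"
    then have ik: "i < n" "k < n" using carr by auto
    show "(A * ?T) $$ (i,k) = (?T * B) $$ (i,k)"
      unfolding mult_diagonal_mat_index[OF carr(1) ik] diagonal_mat_mult_index[OF carr(2) ik]
      by (rule assms(4)[OF ik])
  qed (use carr in auto)
  then show ?thesis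
    using carr diagonal_mat_inverse[of n e] assms(3)
    by (intro similar_mat_intertwine[of A n B ?T ?T']) auto
qed

text \<open>
  Conjugation by the block matrix with rows \<open>(1, x)\<close> and \<open>(0, D)\<close>, where \<open>D\<close> is the diagonal
  matrix of \<open>e\<close>. It preserves the lower right block as soon as \<open>D\<close> commutes with \<open>J\<close>, and changes
  the row \<open>a\<close> into $l x + a D - x J$.
\<close>

lemma similar_mat_bordered:
  fixes e :: "nat \<Rightarrow> 'a :: division_ring"
  assumes J: "J \<in> carrier_mat m m"
    and e0: "\<And>k. k < m \<Longrightarrow> e k \<noteq> 0"
    and comm: "\<And>i k. i < m \<Longrightarrow> k < m \<Longrightarrow> J $$ (i,k) * e k = e i * J $$ (i,k)"
    and row: "\<And>k. k < m \<Longrightarrow> l * x k + a k * e k = c k + (\<Sum>i<m. x i * J $$ (i,k))"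
  shows "similar_mat
    (four_block_mat (mat 1 1 (\<lambda>_. l)) (mat 1 m (\<lambda>(_,k). a k)) (0\<^sub>m m 1) J)
    (four_block_mat (mat 1 1 (\<lambda>_. l)) (mat 1 m (\<lambda>(_,k). c k)) (0\<^sub>m m 1) J)"
    (is "similar_mat ?A ?B")
proof -
  let ?l = "mat 1 1 (\<lambda>_. l)" and ?a = "mat 1 m (\<lambda>(_,k). a k)" and ?c = "mat 1 m (\<lambda>(_,k). c k)"
  define D where "D = mat m m (\<lambda>(i,k). if i = k then e i else 0)"
  define D' where "D' = mat m m (\<lambda>(i,k). if i = k then inverse (e i) else 0)"
  define X where "X = mat 1 m (\<lambda>(_,k). x k)"
  define T where "T = four_block_mat (1\<^sub>m 1) X (0\<^sub>m m 1) D"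
  define T' where "T' = four_block_mat (1\<^sub>m 1) (- (X * D')) (0\<^sub>m m 1) D'"
  have carr: "D \<in> carrier_mat m m" "D' \<in> carrier_mat m m" "X \<in> carrier_mat 1 m"
    "- (X * D') \<in> carrier_mat 1 m"
    by (auto simp: D_def D'_def X_def)
  have blocks: "?l \<in> carrier_mat 1 1" "?a \<in> carrier_mat 1 m" "?c \<in> carrier_mat 1 m"
    "0\<^sub>m m 1 \<in> carrier_mat m 1" "1\<^sub>m 1 \<in> carrier_mat 1 1"
    by auto
  have DD: "D * D' = 1\<^sub>m m" "D' * D = 1\<^sub>m m"
    unfolding D_def D'_def using diagonal_mat_inverse[of m e] e0 by auto
  have JD: "J * D = D * J"
  proof (rule eq_matI)
    fix i k assume "i < dim_row (D * J)" "k < dim_col (D * J)"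
    then have ik: "i < m" "k < m" using carr J by auto
    show "(J * D) $$ (i,k) = (D * J) $$ (i,k)"
      unfolding D_def mult_diagonal_mat_index[OF J ik] diagonal_mat_mult_index[OF J ik]
      by (rule comm[OF ik])
  qed (use carr J in auto)
  have rw: "?l * X + ?a * D = ?c + X * J"
  proof (rule eq_matI)
    fix i k assume "i < dim_row (?c + X * J)" "k < dim_col (?c + X * J)"
    then have ik: "i = 0" "k < m" using carr J by (auto simp: X_def)
    have "(?a * D) $$ (0,k) = a k * e k"
      unfolding D_def using mult_diagonal_mat_index[of ?a 1 m 0 k e] ik by simp
    then show "(?l * X + ?a * D) $$ (i,k) = (?c + X * J) $$ (i,k)"
      using row[OF ik(2)] ik J carr
      by (simp add: scalar_prod_def X_def atLeast0LessThan)
  qed (use carr J in auto)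
  have zero: "- (X * D') + X * D' = 0\<^sub>m 1 m" "X + - X = 0\<^sub>m 1 m" "- 0\<^sub>m m m + 1\<^sub>m m = (1\<^sub>m m :: 'a mat)"
    using carr by (auto intro!: eq_matI)
  have "T * T' = four_block_mat (1\<^sub>m 1) (0\<^sub>m 1 m) (0\<^sub>m m 1) (1\<^sub>m m)"
    unfolding T_def T'_def
    by (subst mult_four_block_mat[OF blocks(5) carr(3) blocks(4) carr(1) blocks(5) carr(4) blocks(4) carr(2)])
      (use carr DD in \<open>simp add: zero\<close>)
  then have TT': "T * T' = 1\<^sub>m (1 + m)" by simp
  have "T' * T = four_block_mat (1\<^sub>m 1) (0\<^sub>m 1 m) (0\<^sub>m m 1) (1\<^sub>m m)"
    unfolding T_def T'_def
    by (subst mult_four_block_mat[OF blocks(5) carr(4) blocks(4) carr(2) blocks(5) carr(3) blocks(4) carr(1)])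
      (use carr DD assoc_mult_mat[OF carr(3) carr(2) carr(1)] in \<open>simp add: zero\<close>)
  then have T'T: "T' * T = 1\<^sub>m (1 + m)" by simp
  have "?A * T = four_block_mat ?l (?l * X + ?a * D) (0\<^sub>m m 1) (J * D)"
    unfolding T_def
    by (subst mult_four_block_mat[OF blocks(1) blocks(2) blocks(4) J blocks(5) carr(3) blocks(4) carr(1)])
      (use carr J in \<open>auto intro!: cong_four_block_mat\<close>)
  also have "\<dots> = four_block_mat ?l (?c + X * J) (0\<^sub>m m 1) (D * J)"
    unfolding rw JD ..
  also have "\<dots> = T * ?B"
    unfolding T_def
    by (subst mult_four_block_mat[OF blocks(5) carr(3) blocks(4) carr(1) blocks(1) blocks(3) blocks(4) J])
      (use carr J in \<open>auto intro!: cong_four_block_mat\<close>)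
  finally have AT: "?A * T = T * ?B" .
  show ?thesis
    by (rule similar_mat_intertwine[OF _ _ _ _ TT' T'T AT])
      (use J carr in \<open>auto simp: T_def T'_def\<close>)
qed

text \<open>
  A row exchange brings a nonzero entry of \<open>v\<close> to the top; a vector with nonzero top entry may
  replace the first column of the identity matrix without destroying invertibility.
\<close>

lemma invertible_mat_with_first_column:
  fixes v :: "'a :: division_ring vec"
  assumes v: "v \<in> carrier_vec (Suc m)" "v \<noteq> 0\<^sub>v (Suc m)"
  shows "\<exists>P Q. P \<in> carrier_mat (Suc m) (Suc m) \<and> Q \<in> carrier_mat (Suc m) (Suc m) \<and>
    P * Q = 1\<^sub>m (Suc m) \<and> Q * P = 1\<^sub>m (Suc m) \<and> col P 0 = v"
proof -
  let ?n = "Suc m"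
  obtain p where p: "p < ?n" "v $ p \<noteq> 0"
    using v by (auto simp: vec_eq_iff)
  define S :: "'a mat" where "S = swaprows_mat ?n 0 p"
  have S: "S \<in> carrier_mat ?n ?n" by (simp add: S_def swaprows_mat_def)
  have SS: "S * S = 1\<^sub>m ?n" unfolding S_def using p by (intro swaprows_mat_inv) auto
  define w where "w = S *\<^sub>v v"
  have w: "w \<in> carrier_vec ?n" using S v by (simp add: w_def)
  have Sw: "S *\<^sub>v w = v"
    unfolding w_def using S v SS by (simp add: assoc_mult_mat_vec[symmetric])
  have "w $ 0 = (\<Sum>k<?n. (if k = p then 1 else 0) * v $ k)"
    unfolding w_def using S v p
    by (auto simp: scalar_prod_def S_def swaprows_mat_def atLeast0LessThan intro!: sum.cong)
  also have "\<dots> = v $ p"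
    using p by (simp add: if_distrib[of "\<lambda>x. x * _"] sum.delta cong: if_cong del: sum.lessThan_Suc)
  finally have w0: "w $ 0 \<noteq> 0" using p by simp
  define E where "E = mat ?n ?n (\<lambda>(i,k). if k = 0 then w $ i else if i = k then 1 else 0)"
  define E' where "E' = mat ?n ?n (\<lambda>(i,k). if k = 0 then (if i = 0 then inverse (w $ 0) else - w $ i * inverse (w $ 0))
      else if i = k then 1 else 0)"
  have E: "E \<in> carrier_mat ?n ?n" "E' \<in> carrier_mat ?n ?n" by (auto simp: E_def E'_def)
  have EE': "E * E' = 1\<^sub>m ?n"
  proof (rule eq_matI)
    fix i k assume "i < dim_row (1\<^sub>m ?n)" "k < dim_col (1\<^sub>m ?n)"
    then have ik: "i < ?n" "k < ?n" by auto
    have "(E * E') $$ (i,k) = (\<Sum>l<?n. E $$ (i,l) * E' $$ (l,k))"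
      using E ik by (simp add: scalar_prod_def atLeast0LessThan)
    also have "\<dots> = E $$ (i,0) * E' $$ (0,k) + (\<Sum>l<m. E $$ (i, Suc l) * E' $$ (Suc l,k))"
      by (rule sum.lessThan_Suc_shift)
    also have "(\<Sum>l<m. E $$ (i, Suc l) * E' $$ (Suc l,k)) = (\<Sum>l<m. if Suc l = i then E' $$ (i,k) else 0)"
      using ik by (intro sum.cong) (auto simp: E_def)
    also have "\<dots> = (if i = 0 then 0 else E' $$ (i,k))"
      using ik by (cases i) (auto simp: sum.delta)
    finally show "(E * E') $$ (i,k) = 1\<^sub>m ?n $$ (i,k)"
      using ik w0 by (auto simp: E_def E'_def)
  qed (use E in auto)
  have E'E: "E' * E = 1\<^sub>m ?n"
  proof (rule eq_matI)
    fix i k assume "i < dim_row (1\<^sub>m ?n)" "k < dim_col (1\<^sub>m ?n)"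
    then have ik: "i < ?n" "k < ?n" by auto
    have "(E' * E) $$ (i,k) = (\<Sum>l<?n. E' $$ (i,l) * E $$ (l,k))"
      using E ik by (simp add: scalar_prod_def atLeast0LessThan)
    also have "\<dots> = E' $$ (i,0) * E $$ (0,k) + (\<Sum>l<m. E' $$ (i, Suc l) * E $$ (Suc l,k))"
      by (rule sum.lessThan_Suc_shift)
    also have "(\<Sum>l<m. E' $$ (i, Suc l) * E $$ (Suc l,k)) = (\<Sum>l<m. if Suc l = i then E $$ (i,k) else 0)"
      using ik by (intro sum.cong) (auto simp: E'_def)
    also have "\<dots> = (if i = 0 then 0 else E $$ (i,k))"
      using ik by (cases i) (auto simp: sum.delta)
    finally show "(E' * E) $$ (i,k) = 1\<^sub>m ?n $$ (i,k)"
      using ik w0 by (auto simp: E_def E'_def mult.assoc)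
  qed (use E in auto)
  have "S * E * (E' * S) = S * (E * (E' * S))"
    using S E by (intro assoc_mult_mat) auto
  also have "E * (E' * S) = E * E' * S"
    using S E by (intro assoc_mult_mat[symmetric]) auto
  finally have 1: "S * E * (E' * S) = 1\<^sub>m ?n"
    using S SS by (simp add: EE')
  have "E' * S * (S * E) = E' * (S * (S * E))"
    using S E by (intro assoc_mult_mat) auto
  also have "S * (S * E) = S * S * E"
    using S E by (intro assoc_mult_mat[symmetric]) auto
  finally have 2: "E' * S * (S * E) = 1\<^sub>m ?n"
    using E SS by (simp add: E'E)
  have "col E 0 = w"
    using w by (intro eq_vecI) (auto simp: E_def)
  then have "col (S * E) 0 = v"
    using Sw by (subst col_mult2[OF S E(1)]) simp_all
  with 1 2 S E show ?thesis
    by (intro exI[of _ "S * E"] exI[of _ "E' * S"]) auto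
qed

section \<open>The quaternionic Jordan form\<close>

text \<open>
  The sequences \<open>d\<close> and \<open>s\<close> are the diagonal and the superdiagonal of a Jordan matrix, and \<open>a\<close> is
  the row bordering it. The four conclusions provide the data for \<open>similar_mat_bordered\<close>: the
  diagonal matrix of \<open>e\<close> is invertible and commutes with the Jordan matrix, and the new row \<open>c\<close> is
  complex.
  
  The imaginary parts of $l$ and $d_k$ are nonnegative, so $l = \bar d_k$ only if $l = d_k$ is real.
  At the indices with $l \ne \bar d_k$, the equation $l y - y \bar d_k = \dots$ can be solved for the
  coefficient $y$ of $j$ in \<open>x\<close>, successively along a block. At the other indices $l$ commutes with
  every quaternion, and the equation only couples $x_{k-1}$ to the entry at $k$: all entries of a block
  but the first are removed by the choice of \<open>x\<close>, and the first one is scaled to one by \<open>e\<close>, which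
  is constant on the block and thus commutes with it.
\<close>

lemma row_elimination:
  fixes a :: "nat \<Rightarrow> quat" and d s :: "nat \<Rightarrow> complex" and l :: complex
  assumes im: "0 \<le> Im l" "\<And>k. 0 \<le> Im (d k)"
    and s: "\<And>k. s k = 0 \<or> s k = 1 \<and> d (Suc k) = d k"
  obtains x e c where
    "\<And>k. e k \<noteq> 0"
    "\<And>k. quat_of_complex (d k) * e k = e k * quat_of_complex (d k)"
    "\<And>k. s k = 0 \<or> e (Suc k) = e k"
    "\<And>k. quat_of_complex l * x k + a k * e k = quat_of_complex (c k) +
      (x k * quat_of_complex (d k) + (if k = 0 then 0 else x (k - 1) * quat_of_complex (s (k - 1))))"
proof -
  \<comment> \<open>The exceptional indices, at which $l$ and $d_k$ are equal and real.\<close>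
  define B where "B k \<longleftrightarrow> Im l = 0 \<and> d k = l" for k
  have BSuc: "s k = 0 \<or> B (Suc k) = B k" for k
    using s[of k] by (auto simp: B_def)
  define g where "g k = (if B k \<and> a k \<noteq> 0 then inverse (a k) else 1)" for k
  define e where "e = rec_nat (g 0) (\<lambda>k r. if s k = 0 then g (Suc k) else r)"
  have e_rec: "e 0 = g 0" "e (Suc k) = (if s k = 0 then g (Suc k) else e k)" for k
    by (simp_all add: e_def)
  have g0: "g k \<noteq> 0" for k by (simp add: g_def)
  have e0: "e k \<noteq> 0" for k
    by (induction k) (auto simp: e_rec g0)
  have e1: "\<not> B k \<Longrightarrow> e k = 1" for k
  proof (induction k)
    case (Suc k)
    then show ?case using BSuc[of k] by (auto simp: e_rec g_def)
  qed (simp add: e_rec g_def)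
  have central: "quat_of_complex l * q = q * quat_of_complex l" if "Im l = 0" for q
    using that by (simp add: quat_eq_iff)
  have "\<forall>k. \<exists>u v. a k = quat_of_complex u + quat_of_complex v * quat_j"
    using quat_split by blast
  then obtain u v where uv: "\<And>k. a k = quat_of_complex (u k) + quat_of_complex (v k) * quat_j"
    by metis
  \<comment> \<open>The recursion continues along a block and restarts at its end, where \<open>s\<close> vanishes.\<close>
  define y where "y = rec_nat (- v 0 / (l - cnj (d 0))) (\<lambda>k r. (r * s k - v (Suc k)) / (l - cnj (d (Suc k))))"
  have y_rec: "y 0 = - v 0 / (l - cnj (d 0))"
    "y (Suc k) = (y k * s k - v (Suc k)) / (l - cnj (d (Suc k)))" for k
    by (simp_all add: y_def)
  define x where "x k = (if B k then (if s k = 0 then 0 else a (Suc k) * e k) else quat_of_complex (y k) * quat_j)" for k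
  define c where "c k = (if B k then (if (k = 0 \<or> s (k - 1) = 0) \<and> a k \<noteq> 0 then 1 else 0) else u k)" for k
  show ?thesis
  proof (rule that[of e x c])
    show "e k \<noteq> 0" for k by (rule e0)
    show "quat_of_complex (d k) * e k = e k * quat_of_complex (d k)" for k
      using e1[of k] central by (cases "B k") (auto simp: B_def)
    show "s k = 0 \<or> e (Suc k) = e k" for k
      by (simp add: e_rec)
    show "quat_of_complex l * x k + a k * e k = quat_of_complex (c k) +
      (x k * quat_of_complex (d k) + (if k = 0 then 0 else x (k - 1) * quat_of_complex (s (k - 1))))" for k
    proof (cases "B k")
      case True
      have lx: "quat_of_complex l * x k = x k * quat_of_complex (d k)"
        using True central by (simp add: B_def)
      have "a k * e k = quat_of_complex (c k) + (if k = 0 then 0 else x (k - 1) * quat_of_complex (s (k - 1)))"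
      proof (cases "k = 0 \<or> s (k - 1) = 0")
        case first: True
        then have "e k = g k"
          by (cases k) (auto simp: e_rec)
        with first True show ?thesis
          by (auto simp: c_def g_def)
      next
        case False
        then obtain i where i: "k = Suc i" "s i = 1" "s i \<noteq> 0"
          using s[of "k - 1"] by (cases k) auto
        moreover have "B i" using BSuc[of i] i True by simp
        ultimately show ?thesis
          using True by (simp add: c_def x_def e_rec)
      qed
      with lx show ?thesis by simp
    next
      case False
      have ne: "l - cnj (d k) \<noteq> 0"
      proof
        assume "l - cnj (d k) = 0"
        then have "Re l = Re (d k)" "Im l = - Im (d k)"
          by (auto simp: complex_eq_iff)
        with im(1) im(2)[of k] have "B k"
          by (simp add: B_def complex_eq_iff)
        with False show False by simp
      qed
      have y: "l * y k + v k = y k * cnj (d k) + (if k = 0 then 0 else y (k - 1) * s (k - 1))"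
        using ne by (cases k) (simp_all add: y_rec field_simps)
      have prev: "(if k = 0 then 0 else x (k - 1) * quat_of_complex (s (k - 1)))
          = quat_of_complex (if k = 0 then 0 else y (k - 1) * s (k - 1)) * quat_j"
      proof (cases k)
        case (Suc i)
        then show ?thesis
          using s[of i] BSuc[of i] False by (auto simp: x_def)
      qed simp
      have "quat_of_complex l * x k + a k * e k
          = quat_of_complex (u k) + quat_of_complex (l * y k + v k) * quat_j"
        using False by (simp add: x_def e1 uv qc.hom_add qc.hom_mult distrib_right mult.assoc)
      also have "\<dots> = quat_of_complex (u k) + (quat_of_complex (y k) * quat_j * quat_of_complex (d k)
          + quat_of_complex (if k = 0 then 0 else y (k - 1) * s (k - 1)) * quat_j)"
        unfolding y using quat_of_complex_quat_j[of "cnj (d k)"]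
        by (simp only: qc.hom_add qc.hom_mult distrib_right mult.assoc complex_cnj_cnj)
      finally show ?thesis
        unfolding prev using False by (simp add: x_def c_def)
    qed
  qed
qed

lemma jordan_bidiagonal_sum_column:
  fixes h :: "nat \<Rightarrow> quat"
  assumes J: "jordan_bidiagonal J" and k: "k < dim_row J"
  shows "(\<Sum>i<dim_row J. h i * quat_of_complex (J $$ (i,k))) =
    h k * quat_of_complex (J $$ (k,k)) +
    (if k = 0 then 0 else h (k - 1) * quat_of_complex (J $$ (k - 1,k)))"
proof -
  have "(\<Sum>i<dim_row J. h i * quat_of_complex (J $$ (i,k))) =
      (\<Sum>i\<in>(if k = 0 then {k} else {k, k - 1}). h i * quat_of_complex (J $$ (i,k)))"
    using J k by (intro sum.mono_neutral_right) (auto simp: jordan_bidiagonal_def)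
  then show ?thesis using k by (cases k) auto
qed

text \<open>
  Since $a j = j \bar a$, conjugation by $j$ replaces a Jordan block by the one with the conjugate
  eigenvalue; the superdiagonal consists of real numbers and is unaffected.
\<close>

lemma is_jordan_form_of_complex:
  assumes C: "C \<in> carrier_mat n n" and sim: "similar_mat A (map_mat quat_of_complex C)"
  shows "\<exists>J. is_jordan_form A J"
proof -
  obtain as where "char_poly C = (\<Prod>a\<leftarrow>as. [:- a, 1:])"
    using char_poly_factorized[OF C] by blast
  then obtain n_as where nf: "jordan_nf C n_as"
    using jordan_nf_exists[OF C] by blast
  define f :: "complex \<Rightarrow> complex" where "f a = (if Im a < 0 then cnj a else a)" for a
  define n_as' where "n_as' = map (\<lambda>(m,a). (m, f a)) n_as"
  let ?N = "sum_list (map fst n_as)"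
  have dims: "sum_list (map fst n_as') = ?N"
    unfolding n_as'_def by (simp add: o_def case_prod_beta)
  let ?J = "jordan_matrix n_as" and ?J' = "jordan_matrix n_as'"
  have idx: "?J' $$ (i,k) = (if i = k then f (?J $$ (i,i)) else ?J $$ (i,k))" if "i < ?N" "k < ?N" for i k
    unfolding n_as'_def by (rule jordan_matrix_map_eigenvalues_index[OF that])
  obtain P Q where PQ: "similar_mat_wit C ?J P Q"
    using nf by (auto simp: jordan_nf_def similar_mat_def)
  note w = similar_mat_witD2[OF C PQ]
  have N: "?N = n" using w(5) by (metis carrier_matD(1) jordan_matrix_dim(1))
  let ?q = "map_mat quat_of_complex"
  have "similar_mat (?q C) (?q ?J)"
  proof (rule similar_matI[of _ _ "?q P" "?q Q" n])
    show "?q P * ?q Q = 1\<^sub>m n" "?q Q * ?q P = 1\<^sub>m n"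
      using w by (simp_all add: qc.mat_hom_mult[symmetric] qc.mat_hom_one)
    show "?q C = ?q P * ?q ?J * ?q Q"
      using w by (simp add: qc.mat_hom_mult[symmetric, of _ n n _ n])
  qed (use w in auto)
  moreover have "similar_mat (?q ?J) (?q ?J')"
  proof (rule similar_mat_diagonal)
    let ?e = "\<lambda>i. if Im (?J $$ (i,i)) < 0 then quat_j else 1"
    show "?e i \<noteq> 0" for i by simp
    have bd: "jordan_bidiagonal ?J" by (rule jordan_bidiagonal_jordan_matrix)
    fix i k assume ik: "i < ?N" "k < ?N"
    show "?q ?J $$ (i,k) * ?e k = ?e i * ?q ?J' $$ (i,k)"
    proof (cases "k = i")
      case True
      then show ?thesis
        using ik by (simp add: idx dims f_def quat_of_complex_quat_j)
    next
      case False
      then have "?J $$ (i,k) = 0 \<or> ?J $$ (i,k) = 1 \<and> ?J $$ (k,k) = ?J $$ (i,i)"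
        using bd ik by (cases "k = Suc i") (auto simp: jordan_bidiagonal_def)
      then show ?thesis
        using False ik by (auto simp: idx dims)
    qed
  qed (auto simp: dims intro!: carrier_matI)
  ultimately have "similar_mat A (?q ?J')"
    using sim similar_mat_trans by blast
  moreover have "0 \<notin> fst ` set n_as'"
    using nf by (force simp: n_as'_def jordan_nf_def)
  moreover have "0 \<le> Im (?J' $$ (i,i))" if "i < dim_row ?J'" for i
    using that by (simp add: idx dims f_def)
  ultimately show ?thesis
    unfolding is_jordan_form_def by blast
qed

theorem quaternion_jordan_form_exists:
  assumes "A \<in> carrier_mat n n"
  shows "\<exists>J. is_jordan_form A J"
  using assms
proof (induction n arbitrary: A)
  case 0
  have "similar_mat A (map_mat quat_of_complex (0\<^sub>m 0 0))"
    using similar_mat_refl[of "A" 0] 0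
    by (metis carrier_matD(1) carrier_matD(2) eq_matI index_map_mat(2,3) index_zero_mat(2,3) not_less_zero)
  then show ?case
    by (intro is_jordan_form_of_complex[of "0\<^sub>m 0 0" 0]) auto
next
  case (Suc m)
  let ?n = "Suc m" and ?q = "map_mat quat_of_complex"
  obtain \<mu> where \<mu>: "standard_eigenvalue A \<mu>"
    using standard_eigenvalue_exists[OF Suc.prems] by auto
  then have im\<mu>: "0 \<le> Im \<mu>" by (simp add: standard_eigenvalue_def)
  obtain \<eta> where \<eta>: "\<eta> \<in> carrier_vec ?n" "\<eta> \<noteq> 0\<^sub>v ?n"
    and ev: "A *\<^sub>v \<eta> = map_vec (\<lambda>x. x * quat_of_complex \<mu>) \<eta>"
    using \<mu> Suc.prems by (auto simp: standard_eigenvalue_def right_eigenvalue_def)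
  obtain P Q where PQ: "P \<in> carrier_mat ?n ?n" "Q \<in> carrier_mat ?n ?n"
    "P * Q = 1\<^sub>m ?n" "Q * P = 1\<^sub>m ?n" and col: "col P 0 = \<eta>"
    using invertible_mat_with_first_column[OF \<eta>] by blast
  define B where "B = Q * (A * P)"
  have B: "B \<in> carrier_mat ?n ?n"
    using PQ Suc.prems by (simp add: B_def)
  have AP: "A * P = P * B"
    unfolding B_def using PQ Suc.prems
    by (subst assoc_mult_mat[symmetric, of P ?n ?n _ ?n _ ?n]) auto
  have simAB: "similar_mat A B"
    by (rule similar_mat_intertwine[OF Suc.prems B PQ AP])
  have Bcol: "B $$ (i,0) = (if i = 0 then quat_of_complex \<mu> else 0)" if i: "i < ?n" for i
  proof -
    have "B $$ (i,0) = row Q i \<bullet> (A *\<^sub>v \<eta>)"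
      unfolding B_def using PQ(1,2) Suc.prems i col_mult2[OF Suc.prems PQ(1), of 0] by (simp add: col)
    also have "\<dots> = (row Q i \<bullet> \<eta>) * quat_of_complex \<mu>"
      unfolding ev using \<eta>(1) by (simp add: scalar_prod_def sum_distrib_right distrib_right mult.assoc)
    also have "row Q i \<bullet> \<eta> = (Q * P) $$ (i,0)"
      using PQ(1,2) i by (simp add: col)
    finally show ?thesis using i by (simp add: PQ(4))
  qed
  define B' where "B' = mat m m (\<lambda>(i,k). B $$ (Suc i, Suc k))"
  let ?\<mu> = "mat 1 1 (\<lambda>_. quat_of_complex \<mu>)"
  let ?b = "mat 1 m (\<lambda>(_,k). B $$ (0, Suc k))"
  have Bblock: "B = four_block_mat ?\<mu> ?b (0\<^sub>m m 1) B'"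
    using B by (intro eq_matI) (auto simp: B'_def Bcol)
  obtain J where J: "is_jordan_form B' J"
    using Suc.IH[of B'] by (auto simp: B'_def)
  then have simJ: "similar_mat B' (?q J)" and imJ: "\<And>i. i < dim_row J \<Longrightarrow> 0 \<le> Im (J $$ (i,i))"
    and bd: "jordan_bidiagonal J"
    by (auto simp: is_jordan_form_def jordan_bidiagonal_jordan_matrix)
  have carr: "B' \<in> carrier_mat m m" by (simp add: B'_def)
  obtain r where "{B', ?q J} \<subseteq> carrier_mat r r" 
    using similar_matD[OF simJ] by blast
  with carr have Jc: "J \<in> carrier_mat m m" by auto
  have "\<exists>B0. B0 \<in> carrier_mat 1 m \<and> similar_mat (four_block_mat ?\<mu> ?b (0\<^sub>m m 1) B')
      (four_block_mat ?\<mu> B0 (0\<^sub>m m 1) (?q J))"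
    by (rule similar_mat_four_block_0_ex[OF _ simJ]) (use carr similar_mat_refl[of ?\<mu> 1] in auto)
  then obtain B0 where B0: "B0 \<in> carrier_mat 1 m"
    and sim0: "similar_mat B (four_block_mat ?\<mu> B0 (0\<^sub>m m 1) (?q J))"
    unfolding Bblock[symmetric] by blast
  define d where "d k = (if k < m then J $$ (k,k) else 0)" for k
  define s where "s k = (if Suc k < m then J $$ (k, Suc k) else 0)" for k
  have d_im: "0 \<le> Im (d k)" for k using imJ Jc by (auto simp: d_def)
  have s: "s k = 0 \<or> s k = 1 \<and> d (Suc k) = d k" for k
    using bd Jc by (auto simp: jordan_bidiagonal_def s_def d_def)
  obtain x e c where xec: "\<And>k. e k \<noteq> 0"
    "\<And>k. quat_of_complex (d k) * e k = e k * quat_of_complex (d k)"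
    "\<And>k. s k = 0 \<or> e (Suc k) = e k"
    "\<And>k. quat_of_complex \<mu> * x k + B0 $$ (0,k) * e k = quat_of_complex (c k) +
      (x k * quat_of_complex (d k) + (if k = 0 then 0 else x (k - 1) * quat_of_complex (s (k - 1))))"
  proof (rule row_elimination[of \<mu> d s "\<lambda>k. B0 $$ (0,k)", OF im\<mu>])
    show "0 \<le> Im (d k)" for k by (rule d_im)
    show "s k = 0 \<or> s k = 1 \<and> d (Suc k) = d k" for k by (rule s)
  qed (rule that)
  let ?c = "mat 1 m (\<lambda>(_,k). quat_of_complex (c k))"
  have "similar_mat (four_block_mat ?\<mu> (mat 1 m (\<lambda>(_,k). B0 $$ (0,k))) (0\<^sub>m m 1) (?q J))
      (four_block_mat ?\<mu> ?c (0\<^sub>m m 1) (?q J))"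
  proof (rule similar_mat_bordered)
    show "?q J $$ (i,k) * e k = e i * ?q J $$ (i,k)" if ik: "i < m" "k < m" for i k
    proof (cases "k = i")
      case True
      then show ?thesis using ik Jc xec(2)[of i] by (simp add: d_def)
    next
      case False
      show ?thesis
      proof (cases "k = Suc i")
        case True
        then show ?thesis using ik Jc s[of i] xec(3)[of i] by (auto simp: s_def)
      next
        case no: False
        then show ?thesis using ik Jc False bd by (simp add: jordan_bidiagonal_def)
      qed
    qed
    show "quat_of_complex \<mu> * x k + B0 $$ (0,k) * e k = quat_of_complex (c k) + (\<Sum>i<m. x i * ?q J $$ (i,k))"
      if k: "k < m" for k
      using xec(4)[of k] jordan_bidiagonal_sum_column[OF bd, of k x] k Jc
      by (cases k) (simp_all only: d_def s_def, simp_all)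
  qed (use Jc xec(1) in auto)
  also have "mat 1 m (\<lambda>(_,k). B0 $$ (0,k)) = B0"
    using B0 by (intro eq_matI) auto
  also have "four_block_mat ?\<mu> ?c (0\<^sub>m m 1) (?q J)
      = ?q (four_block_mat (mat 1 1 (\<lambda>_. \<mu>)) (mat 1 m (\<lambda>(_,k). c k)) (0\<^sub>m m 1) J)" (is "_ = map_mat quat_of_complex ?C")
    using Jc by (intro eq_matI) auto
  finally have "similar_mat A (?q ?C)"
    by (rule similar_mat_trans[OF simAB similar_mat_trans[OF sim0]])
  moreover have "?C \<in> carrier_mat (1 + m) (1 + m)"
    using Jc by auto
  ultimately show ?case
    by (rule is_jordan_form_of_complex[rotated])
qed

section \<open>Eigenvalues and multiplicities from the Jordan form\<close>

lemma jordan_form: "A \<in> carrier_mat n n \<Longrightarrow> is_jordan_form A (jordan_form A)"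
  unfolding jordan_form_def using quaternion_jordan_form_exists by (rule someI_ex)

lemma jordan_bidiagonal_mult_vec_index:
  assumes J: "jordan_bidiagonal J" and y: "y \<in> carrier_vec (dim_row J)" and i: "i < dim_row J"
  shows "(map_mat quat_of_complex J *\<^sub>v y) $ i = quat_of_complex (J $$ (i,i)) * y $ i +
    (if Suc i < dim_row J then quat_of_complex (J $$ (i, Suc i)) * y $ Suc i else 0)"
proof -
  have "(map_mat quat_of_complex J *\<^sub>v y) $ i = (\<Sum>k<dim_row J. quat_of_complex (J $$ (i,k)) * y $ k)"
    using J y i by (simp add: scalar_prod_def atLeast0LessThan jordan_bidiagonal_def)
  also have "\<dots> = (\<Sum>k\<in>(if Suc i < dim_row J then {i, Suc i} else {i}). quat_of_complex (J $$ (i,k)) * y $ k)"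
    using J i by (intro sum.mono_neutral_right) (auto simp: jordan_bidiagonal_def split: if_splits)
  finally show ?thesis by auto
qed

lemma right_eigenvalue_similar:
  assumes "similar_mat A B" and ev: "right_eigenvalue B q"
  shows "right_eigenvalue A q"
proof -
  obtain n P Q where w: "{A,B,P,Q} \<subseteq> carrier_mat n n" "P * Q = 1\<^sub>m n" "Q * P = 1\<^sub>m n" "A = P * B * Q"
    using similar_matD[OF assms(1)] by blast
  then have carr: "A \<in> carrier_mat n n" "B \<in> carrier_mat n n" "P \<in> carrier_mat n n" "Q \<in> carrier_mat n n"
    by auto
  obtain \<eta> where \<eta>: "\<eta> \<in> carrier_vec n" "\<eta> \<noteq> 0\<^sub>v n" "B *\<^sub>v \<eta> = map_vec (\<lambda>x. x * q) \<eta>"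
    using ev carr by (auto simp: right_eigenvalue_def)
  have QP\<eta>: "Q *\<^sub>v (P *\<^sub>v \<eta>) = \<eta>"
    using carr \<eta>(1) w(3) by (simp add: assoc_mult_mat_vec[symmetric, of Q n n P n])
  have P\<eta>: "P *\<^sub>v \<eta> \<in> carrier_vec n"
    using carr \<eta> by simp
  have "A *\<^sub>v (P *\<^sub>v \<eta>) = P * B *\<^sub>v (Q *\<^sub>v (P *\<^sub>v \<eta>))"
    unfolding w(4) using carr P\<eta> by (intro assoc_mult_mat_vec[of _ n n _ n]) auto
  also have "\<dots> = P *\<^sub>v (B *\<^sub>v \<eta>)"
    unfolding QP\<eta> using carr \<eta>(1) by (intro assoc_mult_mat_vec[of _ n n _ n]) auto
  also have "\<dots> = map_vec (\<lambda>x. x * q) (P *\<^sub>v \<eta>)"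
    unfolding \<eta>(3) using carr \<eta>(1)
    by (intro eq_vecI) (auto simp: scalar_prod_def sum_distrib_right mult.assoc)
  finally have "A *\<^sub>v (P *\<^sub>v \<eta>) = map_vec (\<lambda>x. x * q) (P *\<^sub>v \<eta>)" .
  moreover have "P *\<^sub>v \<eta> \<noteq> 0\<^sub>v n"
  proof
    assume "P *\<^sub>v \<eta> = 0\<^sub>v n"
    then have "\<eta> = Q *\<^sub>v 0\<^sub>v n" using QP\<eta> by simp
    also have "\<dots> = 0\<^sub>v n" using carr by (intro eq_vecI) auto
    finally show False using \<eta>(2) by simp
  qed
  ultimately show ?thesis
    using P\<eta> carr unfolding right_eigenvalue_def by auto
qed

text \<open>
  For an eigenvector \<open>y\<close> of \<open>J\<close>, the row of its last nonzero entry $y_i$ reads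
  $J_{ii} y_i = y_i \mu$, which forces $J_{ii} = \mu$ in the upper half plane. Conversely, the first
  index with diagonal entry $\mu$ starts a Jordan block, so its unit vector is an eigenvector.
\<close>

lemma standard_eigenvalue_iff_diagonal:
  assumes J: "jordan_bidiagonal J" and im: "\<And>i. i < dim_row J \<Longrightarrow> 0 \<le> Im (J $$ (i,i))"
    and sim: "similar_mat A (map_mat quat_of_complex J)"
  shows "standard_eigenvalue A \<mu> \<longleftrightarrow> (\<exists>i<dim_row J. J $$ (i,i) = \<mu>)"
proof
  let ?n = "dim_row J" and ?J = "map_mat quat_of_complex J"
  assume "standard_eigenvalue A \<mu>"
  then have \<mu>: "0 \<le> Im \<mu>" "right_eigenvalue ?J (quat_of_complex \<mu>)"
    using right_eigenvalue_similar[OF similar_mat_sym[OF sim]] by (auto simp: standard_eigenvalue_def)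
  then obtain y where y: "y \<in> carrier_vec ?n" "y \<noteq> 0\<^sub>v ?n" "?J *\<^sub>v y = map_vec (\<lambda>x. x * quat_of_complex \<mu>) y"
    by (auto simp: right_eigenvalue_def)
  let ?S = "{i. i < ?n \<and> y $ i \<noteq> 0}"
  have "?S \<noteq> {}" using y by (auto simp: vec_eq_iff)
  moreover have fin: "finite ?S" by simp
  ultimately have "Max ?S \<in> ?S" by (intro Max_in)
  define i where "i = Max ?S"
  have i: "i < ?n" "y $ i \<noteq> 0" using \<open>Max ?S \<in> ?S\<close> by (auto simp: i_def)
  have last: "y $ Suc i = 0" if "Suc i < ?n"
  proof (rule ccontr)
    assume "y $ Suc i \<noteq> 0"
    with that have "Suc i \<le> Max ?S" by (intro Max_ge[OF fin]) auto
    then show False by (simp add: i_def)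
  qed
  have "quat_of_complex (J $$ (i,i)) * y $ i = (?J *\<^sub>v y) $ i"
    unfolding jordan_bidiagonal_mult_vec_index[OF J y(1) i(1)] using last by simp
  also have "\<dots> = y $ i * quat_of_complex \<mu>"
    unfolding y(3) using i y(1) by simp
  finally have "J $$ (i,i) = \<mu>"
    using similar_upper_half_plane_eq[OF _ i(2) im[OF i(1)] \<mu>(1)] by simp
  with i show "\<exists>i<?n. J $$ (i,i) = \<mu>" by blast
next
  let ?n = "dim_row J" and ?J = "map_mat quat_of_complex J"
  assume ex: "\<exists>i<?n. J $$ (i,i) = \<mu>"
  define i where "i = (LEAST i. i < ?n \<and> J $$ (i,i) = \<mu>)"
  have i: "i < ?n" "J $$ (i,i) = \<mu>"
    using LeastI_ex[OF ex] by (auto simp: i_def)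
  have first: "J $$ (k,i) = 0" if k: "Suc k = i" for k
  proof (rule ccontr)
    assume "J $$ (k,i) \<noteq> 0"
    then have "J $$ (k,k) = \<mu>" using J i k by (auto simp: jordan_bidiagonal_def)
    then have "i \<le> k" unfolding i_def using k i by (intro Least_le) auto
    with k show False by simp
  qed
  have "?J *\<^sub>v unit_vec ?n i = map_vec (\<lambda>x. x * quat_of_complex \<mu>) (unit_vec ?n i)"
  proof (rule eq_vecI)
    fix k assume "k < dim_vec (map_vec (\<lambda>x. x * quat_of_complex \<mu>) (unit_vec ?n i :: quat vec))"
    then have k: "k < ?n" by simp
    show "(?J *\<^sub>v unit_vec ?n i) $ k = map_vec (\<lambda>x. x * quat_of_complex \<mu>) (unit_vec ?n i) $ k"
      unfolding jordan_bidiagonal_mult_vec_index[OF J unit_vec_carrier k]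
      using k i first[of k] by (cases "k = i"; cases "Suc k = i") auto
  qed simp
  then have "right_eigenvalue ?J (quat_of_complex \<mu>)"
    unfolding right_eigenvalue_def using i(1) by (intro bexI[of _ "unit_vec ?n i"]) auto
  then show "standard_eigenvalue A \<mu>"
    using right_eigenvalue_similar[OF sim] im[OF i(1)] i(2) by (simp add: standard_eigenvalue_def)
qed

lemma card_diagonal_jordan_matrix:
  fixes \<mu> :: complex
  shows "card {i. i < sum_list (map fst n_as) \<and> jordan_matrix n_as $$ (i,i) = \<mu>}
    = (\<Sum>m\<leftarrow>map fst [(m, a)\<leftarrow>n_as. a = \<mu>]. m)"
proof (induction n_as)
  case (Cons p n_as)
  obtain m a where p: "p = (m,a)" by force
  let ?N = "sum_list (map fst n_as)"
  let ?S = "{i. i < ?N \<and> jordan_matrix n_as $$ (i,i) = \<mu>}"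
  have "{i. i < sum_list (map fst (p # n_as)) \<and> jordan_matrix (p # n_as) $$ (i,i) = \<mu>}
      = (if a = \<mu> then {..<m} else {}) \<union> (\<lambda>i. i + m) ` ?S" (is "?L = ?R")
  proof (rule Set.set_eqI)
    fix i
    have shift: "i \<in> (\<lambda>i. i + m) ` ?S \<longleftrightarrow> m \<le> i \<and> i - m \<in> ?S"
    proof
      assume "m \<le> i \<and> i - m \<in> ?S"
      then show "i \<in> (\<lambda>i. i + m) ` ?S" by (intro image_eqI[of _ _ "i - m"]) auto
    qed auto
    then show "i \<in> ?L \<longleftrightarrow> i \<in> ?R"
      unfolding p Un_iff shift by (cases "i < m") (auto simp: jordan_matrix_Cons_index)
  qed
  moreover have "card ?R = card (if a = \<mu> then {..<m} else {}) + card ?S"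
    by (subst card_Un_disjoint) (auto simp: card_image)
  ultimately show ?case
    using Cons by (simp add: p)
qed simp

lemma superdiagonal_jordan_matrix:
  fixes \<mu> :: complex
  shows "(\<exists>i. Suc i < sum_list (map fst n_as) \<and> jordan_matrix n_as $$ (i,i) = \<mu> \<and> jordan_matrix n_as $$ (i, Suc i) \<noteq> 0)
    \<longleftrightarrow> (\<exists>m\<in>set (map fst [(m, a)\<leftarrow>n_as. a = \<mu>]). 1 < m)"
proof (induction n_as)
  case (Cons p n_as)
  obtain m a where p: "p = (m,a)" by force
  let ?N = "sum_list (map fst n_as)"
  let ?P = "\<lambda>n_as i. Suc i < sum_list (map fst n_as) \<and> jordan_matrix n_as $$ (i,i) = \<mu> \<and> jordan_matrix n_as $$ (i, Suc i) \<noteq> 0"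
  have "(\<exists>i. ?P (p # n_as) i) \<longleftrightarrow> a = \<mu> \<and> 1 < m \<or> (\<exists>i. ?P n_as i)"
  proof
    assume "\<exists>i. ?P (p # n_as) i"
    then obtain i where i: "?P (p # n_as) i" by blast
    show "a = \<mu> \<and> 1 < m \<or> (\<exists>i. ?P n_as i)"
    proof (cases "i < m")
      case True
      then show ?thesis using i by (auto simp: p jordan_matrix_Cons_index split: if_splits)
    next
      case False
      then have "?P n_as (i - m)" using i by (auto simp: p jordan_matrix_Cons_index Suc_diff_le)
      then show ?thesis by blast
    qed
  next
    assume "a = \<mu> \<and> 1 < m \<or> (\<exists>i. ?P n_as i)"
    then show "\<exists>i. ?P (p # n_as) i"
    proof
      assume "a = \<mu> \<and> 1 < m"
      then show ?thesis by (intro exI[of _ 0]) (auto simp: p jordan_matrix_Cons_index)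
    next
      assume "\<exists>i. ?P n_as i"
      then obtain i where "?P n_as i" by blast
      then show ?thesis by (intro exI[of _ "i + m"]) (auto simp: p jordan_matrix_Cons_index)
    qed
  qed
  then show ?case
    using Cons by (auto simp: p)
qed simp

lemma sum_list_eq_sum_min_one_iff:
  "0 \<notin> set ms \<Longrightarrow> sum_list ms = (\<Sum>m\<leftarrow>ms. min 1 m) \<longleftrightarrow> (\<forall>m\<in>set ms. m \<le> (1::nat))"
proof (induction ms)
  case (Cons m ms)
  have "(\<Sum>m\<leftarrow>ms. min 1 m) \<le> sum_list ms"
    by (induction ms) auto
  with Cons show ?case by auto
qed simp

text \<open>
  The algebraic multiplicity adds up the sizes of the blocks of $\mu$ and the geometric
  multiplicity counts these blocks. They agree iff all the blocks have size one, that is, iff the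
  superdiagonal vanishes next to each diagonal entry $\mu$.
\<close>

lemma multiplicities_eq_iff:
  assumes A: "A \<in> carrier_mat n n"
  shows "algebraic_multiplicity A \<mu> = geometric_multiplicity A \<mu> \<longleftrightarrow>
    (\<forall>i. Suc i < dim_row (jordan_form A) \<longrightarrow> jordan_form A $$ (i,i) = \<mu> \<longrightarrow> jordan_form A $$ (i, Suc i) = 0)"
proof -
  obtain n_as where n_as: "0 \<notin> fst ` set n_as" "jordan_form A = jordan_matrix n_as"
    using jordan_form[OF A] by (auto simp: is_jordan_form_def)
  let ?ms = "map fst [(m, a)\<leftarrow>n_as. a = \<mu>]"
  have "geometric_multiplicity A \<mu> = dim_gen_eigenspace (jordan_form A) \<mu> 1"
    unfolding geometric_multiplicity_def dim_gen_eigenspace_def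
    by (simp add: n_as)
  also have "\<dots> = (\<Sum>m\<leftarrow>?ms. min 1 m)"
    unfolding n_as dim_gen_eigenspace_jordan_matrix ..
  finally have geo: "geometric_multiplicity A \<mu> = (\<Sum>m\<leftarrow>?ms. min 1 m)" .
  have alg: "algebraic_multiplicity A \<mu> = sum_list ?ms"
    unfolding algebraic_multiplicity_def n_as
    using card_diagonal_jordan_matrix[of n_as \<mu>] by simp
  have "0 \<notin> set ?ms"
    using n_as(1) by auto
  then show ?thesis
    unfolding geo alg
    using sum_list_eq_sum_min_one_iff[of ?ms] superdiagonal_jordan_matrix[of n_as \<mu>]
    by (auto simp: n_as not_less)
qed

section \<open>The exponential of a Jordan matrix\<close>

text \<open>
  The matrix $e^{tJ}$ for \<open>jordan_bidiagonal J\<close>. The product of superdiagonal entries is one if \<open>i\<close> and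
  \<open>k\<close> lie in the same Jordan block, and zero otherwise.
\<close>

definition jordan_exp :: "complex mat \<Rightarrow> real \<Rightarrow> complex mat" where
  "jordan_exp J t = mat (dim_row J) (dim_row J) (\<lambda>(i,k).
    if i \<le> k then (\<Prod>l=i..<k. J $$ (l, Suc l)) * (of_real t ^ (k - i) / fact (k - i)) * exp (J $$ (i,i) * of_real t)
    else 0)"

lemma jordan_exp_carrier [simp]: "jordan_exp J t \<in> carrier_mat (dim_row J) (dim_row J)"
  by (simp add: jordan_exp_def)

lemma jordan_exp_zero: "jordan_exp J 0 = 1\<^sub>m (dim_row J)"
  by (intro eq_matI) (auto simp: jordan_exp_def)

text \<open>
  The right-hand side is the entry of $J e^{(t - t_0) J}$. Differentiating the power of $t$ gives
  the power in the entry at \<open>Suc i\<close> and \<open>k\<close>, whose product of superdiagonal entries lacks just the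
  factor at \<open>i\<close>. If that factor is nonzero, the diagonal entries at \<open>i\<close> and \<open>Suc i\<close> agree, so both
  entries carry the same exponential.
\<close>

lemma jordan_exp_has_derivative:
  assumes J: "jordan_bidiagonal J" and i: "i < dim_row J" and k: "k < dim_row J"
  shows "((\<lambda>t. jordan_exp J (t - t0) $$ (i,k)) has_vector_derivative
    J $$ (i,i) * jordan_exp J (t - t0) $$ (i,k) +
      (if Suc i < dim_row J then J $$ (i, Suc i) * jordan_exp J (t - t0) $$ (Suc i,k) else 0)) (at t within S)"
proof (cases "i \<le> k")
  case False
  with i k show ?thesis by (simp add: jordan_exp_def)
next
  case ik: True
  let ?d = "J $$ (i,i)" and ?t = "complex_of_real t - of_real t0"
  define c where "c = (\<Prod>l=i..<k. J $$ (l, Suc l))"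
  have *: "jordan_exp J (s - t0) $$ (i,k)
      = c * ((of_real s - of_real t0) ^ (k - i) / fact (k - i)) * exp (?d * (of_real s - of_real t0))" for s
    using i k ik by (simp add: jordan_exp_def c_def)
  have exp': "((\<lambda>z. exp (?d * (z - of_real t0))) has_field_derivative exp (?d * ?t) * ?d) (at (of_real t))"
    by (auto intro!: derivative_eq_intros)
  show ?thesis
  proof (cases "i = k")
    case True
    have "((\<lambda>s. exp (?d * (complex_of_real s - of_real t0))) has_vector_derivative exp (?d * ?t) * ?d) (at t within S)"
      by (rule has_vector_derivative_real_field[OF exp'])
    then show ?thesis
      unfolding * using True i k by (simp add: c_def jordan_exp_def mult.commute)
  next
    case False
    define m where "m = k - Suc i"
    have m: "k - i = Suc m" "k - Suc i = m" and Si: "Suc i < dim_row J" "Suc i \<le> k"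
      using False ik k by (auto simp: m_def)
    define c' where "c' = (\<Prod>l=Suc i..<k. J $$ (l, Suc l))"
    have c: "c = J $$ (i, Suc i) * c'"
      unfolding c_def c'_def using Si by (subst prod.atLeast_Suc_lessThan) auto
    have pow': "((\<lambda>z. (z - of_real t0) ^ Suc m / fact (Suc m)) has_field_derivative ?t ^ m / fact m) (at (of_real t))"
    proof -
      have "((\<lambda>z. (z - of_real t0) ^ Suc m / fact (Suc m)) has_field_derivative
          (of_nat (Suc m) * ?t ^ m) / fact (Suc m)) (at (of_real t))"
        using DERIV_power_Suc[of "\<lambda>z. z - of_real t0" 1 "of_real t" UNIV m]
        by (intro DERIV_cdivide) (simp add: DERIV_diff[OF DERIV_ident DERIV_const, simplified])
      also have "(of_nat (Suc m) * ?t ^ m) / fact (Suc m) = ?t ^ m / fact m"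
        by (simp del: of_nat_Suc)
      finally show ?thesis .
    qed
    have "((\<lambda>z. c * ((z - of_real t0) ^ Suc m / fact (Suc m)) * exp (?d * (z - of_real t0)))
        has_field_derivative c * (?t ^ m / fact m) * exp (?d * ?t)
          + exp (?d * ?t) * ?d * (c * (?t ^ Suc m / fact (Suc m)))) (at (of_real t))"
      by (rule DERIV_mult[OF DERIV_cmult[OF pow'] exp'])
    note this[THEN has_vector_derivative_real_field, of S]
    also have "c * (?t ^ m / fact m) * exp (?d * ?t) = J $$ (i, Suc i) * jordan_exp J (t - t0) $$ (Suc i, k)"
    proof (cases "J $$ (i, Suc i) = 0")
      case False
      then have "J $$ (Suc i, Suc i) = ?d"
        using J Si by (auto simp: jordan_bidiagonal_def)
      then show ?thesis
        using Si k by (simp add: c jordan_exp_def c'_def m)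
    qed (simp add: c)
    finally show ?thesis
      unfolding * m using Si by (simp add: algebra_simps del: power_Suc fact_Suc)
  qed
qed

text \<open>
  One term of the series of $e^{-rt}$ is at most the whole sum.
\<close>

lemma power_fact_exp_bound:
  fixes r t :: real
  assumes "r < 0" "0 \<le> t"
  shows "t ^ m / fact m * exp (r * t) \<le> (1 / - r) ^ m"
proof -
  let ?x = "- r * t"
  have x: "0 \<le> ?x" using assms by (simp add: mult_nonpos_nonneg)
  have "?x ^ m /\<^sub>R fact m = (\<Sum>n\<in>{m}. ?x ^ n /\<^sub>R fact n)" by simp
  also have "\<dots> \<le> (\<Sum>n. ?x ^ n /\<^sub>R fact n)"
    using x by (intro sum_le_suminf summable_exp_generic) auto
  finally have "?x ^ m / fact m \<le> exp ?x"
    by (simp add: exp_def divide_inverse mult.commute)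
  then have "?x ^ m / fact m * exp (r * t) \<le> exp ?x * exp (r * t)"
    by (intro mult_right_mono) auto
  also have "\<dots> = 1"
    by (simp add: exp_add[symmetric])
  finally have "(- r) ^ m * (t ^ m / fact m * exp (r * t)) \<le> 1"
    by (simp only: power_mult_distrib mult.assoc times_divide_eq_right times_divide_eq_left)
  then show ?thesis
    unfolding power_one_over using assms by (subst pos_le_divide_eq) (simp_all only: mult.commute zero_less_power neg_0_less_iff_less)
qed

definition bounded_after :: "real \<Rightarrow> (real \<Rightarrow> 'a :: real_normed_vector) \<Rightarrow> bool" where
  "bounded_after t0 f \<longleftrightarrow> (\<exists>C. \<forall>t\<ge>t0. norm (f t) \<le> C)"

lemma norm_jordan_exp:
  assumes "i \<le> k" "k < dim_row J" "0 \<le> t"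
  shows "norm (jordan_exp J t $$ (i,k)) =
    norm (\<Prod>l=i..<k. J $$ (l, Suc l)) * (t ^ (k - i) / fact (k - i) * exp (Re (J $$ (i,i)) * t))"
  using assms by (simp add: jordan_exp_def norm_mult norm_divide norm_power)

lemma jordan_exp_bounded_iff:
  assumes J: "jordan_bidiagonal J"
  shows "(\<forall>i<dim_row J. \<forall>k<dim_row J. bounded_after t0 (\<lambda>t. jordan_exp J (t - t0) $$ (i,k))) \<longleftrightarrow>
    (\<forall>i<dim_row J. Re (J $$ (i,i)) \<le> 0 \<and>
      (Re (J $$ (i,i)) = 0 \<longrightarrow> Suc i < dim_row J \<longrightarrow> J $$ (i, Suc i) = 0))"
    (is "?L \<longleftrightarrow> ?R")
proof
  assume bd: ?L
  have bound: "\<exists>C. \<forall>t\<ge>0. norm (jordan_exp J t $$ (i,k)) \<le> C" if ik: "i < dim_row J" "k < dim_row J" for i k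
  proof -
    obtain C where C: "\<And>t. t \<ge> t0 \<Longrightarrow> norm (jordan_exp J (t - t0) $$ (i,k)) \<le> C"
      using bd[unfolded bounded_after_def, rule_format, OF ik] by blast
    show ?thesis
      using C[of "_ + t0"] by (intro exI[of _ C]) auto
  qed
  show ?R
  proof (intro allI impI conjI)
    fix i assume i: "i < dim_row J"
    let ?r = "Re (J $$ (i,i))"
    obtain C where C: "\<And>t. t \<ge> 0 \<Longrightarrow> norm (jordan_exp J t $$ (i,i)) \<le> C"
      using bound[OF i i] by blast
    have Cexp: "exp (?r * t) \<le> C" if "t \<ge> 0" for t
      using C[OF that] i that by (simp add: norm_jordan_exp)
    have C1: "1 \<le> C" using Cexp[of 0] by simp
    show "?r \<le> 0"
    proof (rule ccontr)
      assume "\<not> ?r \<le> 0"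
      then have "exp C \<le> C"
        using C1 Cexp[of "C / ?r"] by simp
      with exp_ge_add_one_self[of C] show False by linarith
    qed
    assume r0: "?r = 0" and Si: "Suc i < dim_row J"
    show "J $$ (i, Suc i) = 0"
    proof (rule ccontr)
      assume "J $$ (i, Suc i) \<noteq> 0"
      then have s: "J $$ (i, Suc i) = 1" using J Si by (auto simp: jordan_bidiagonal_def)
      obtain C where C: "\<And>t. t \<ge> 0 \<Longrightarrow> norm (jordan_exp J t $$ (i,Suc i)) \<le> C"
        using bound[OF i Si] by blast
      \<comment> \<open>The entry next to the diagonal has absolute value $t$.\<close>
      have "\<bar>C\<bar> + 1 \<le> C"
        using C[of "\<bar>C\<bar> + 1"] Si by (simp add: norm_jordan_exp s r0)
      then show False by simp
    qed
  qed
next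
  assume R: ?R
  show ?L
  proof (intro allI impI)
    fix i k assume ik: "i < dim_row J" "k < dim_row J"
    let ?r = "Re (J $$ (i,i))" and ?c = "\<Prod>l=i..<k. J $$ (l, Suc l)"
    have "\<exists>C. \<forall>t\<ge>0. norm (jordan_exp J t $$ (i,k)) \<le> C"
    proof (cases "i \<le> k")
      case False
      then show ?thesis using ik by (intro exI[of _ 0]) (simp add: jordan_exp_def)
    next
      case le: True
      show ?thesis
      proof (cases "?r = 0")
        case True
        show ?thesis
        proof (cases "i = k")
          case True
          then show ?thesis
            using ik \<open>?r = 0\<close> by (intro exI[of _ 1]) (simp add: norm_jordan_exp)
        next
          case False
          then have "?c = 0"
            using R ik le \<open>?r = 0\<close> by (intro prod_zero) (auto intro!: bexI[of _ i])
          have "norm (jordan_exp J t $$ (i,k)) \<le> 0" if "t \<ge> 0" for t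
            unfolding norm_jordan_exp[OF le ik(2) that] \<open>?c = 0\<close> by simp
          then show ?thesis by blast
        qed
      next
        case False
        then have "?r < 0" using R ik by force
        then show ?thesis
          using ik le
          by (intro exI[of _ "norm ?c * (1 / - ?r) ^ (k - i)"] allI impI)
            (simp only: norm_jordan_exp, intro mult_left_mono power_fact_exp_bound norm_ge_zero)
      qed
    qed
    then obtain C where C: "\<And>t. t \<ge> 0 \<Longrightarrow> norm (jordan_exp J t $$ (i,k)) \<le> C" by blast
    show "bounded_after t0 (\<lambda>t. jordan_exp J (t - t0) $$ (i,k))"
      unfolding bounded_after_def by (intro exI[of _ C]) (auto intro!: C)
  qed
qed

lemma tendsto_shift_at_top:
  fixes t0 :: real
  shows "((\<lambda>t. f (t - t0)) \<longlongrightarrow> l) at_top \<longleftrightarrow> (f \<longlongrightarrow> l) at_top"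
proof -
  have shift: "filterlim (\<lambda>t. t + c) at_top at_top" for c :: real
    by (rule filterlim_tendsto_add_at_top[OF tendsto_const filterlim_ident, of c, unfolded add.commute[of c]])
  show ?thesis
    using filterlim_compose[OF _ shift[of t0], of "\<lambda>t. f (t - t0)" "nhds l"]
      filterlim_compose[OF _ shift[of "- t0"], of f "nhds l"] by auto
qed

lemma exp_mult_tendsto_zero:
  fixes r :: real
  assumes "r < 0"
  shows "((\<lambda>t. exp (r * t)) \<longlongrightarrow> 0) at_top"
  by (rule filterlim_compose[OF exp_at_bot])
    (rule filterlim_tendsto_neg_mult_at_bot[OF tendsto_const assms filterlim_ident])

text \<open>
  Half of the exponential decay absorbs the power of $t$, and the other half drives the entry to
  zero.
\<close>

lemma jordan_exp_tendsto_zero_iff: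
  "(\<forall>i<dim_row J. \<forall>k<dim_row J. ((\<lambda>t. jordan_exp J (t - t0) $$ (i,k)) \<longlongrightarrow> 0) at_top) \<longleftrightarrow>
    (\<forall>i<dim_row J. Re (J $$ (i,i)) < 0)" (is "?L \<longleftrightarrow> ?R")
proof -
  have "?L \<longleftrightarrow> (\<forall>i<dim_row J. \<forall>k<dim_row J. ((\<lambda>t. jordan_exp J t $$ (i,k)) \<longlongrightarrow> 0) at_top)"
    using tendsto_shift_at_top[of "\<lambda>t. jordan_exp J t $$ (_,_)" t0] by blast
  also have "\<dots> \<longleftrightarrow> ?R"
  proof (intro iffI allI impI)
    fix i assume lim: "\<forall>i<dim_row J. \<forall>k<dim_row J. ((\<lambda>t. jordan_exp J t $$ (i,k)) \<longlongrightarrow> 0) at_top"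
      and i: "i < dim_row J"
    show "Re (J $$ (i,i)) < 0"
    proof (rule ccontr)
      assume r: "\<not> Re (J $$ (i,i)) < 0"
      have "((\<lambda>t. norm (jordan_exp J t $$ (i,i))) \<longlongrightarrow> 0) at_top"
        using lim i by (intro tendsto_norm_zero) auto
      then have "\<forall>\<^sub>F t in at_top. norm (jordan_exp J t $$ (i,i)) < 1"
        by (rule order_tendstoD) simp
      then obtain T where T: "\<And>t. t \<ge> T \<Longrightarrow> norm (jordan_exp J t $$ (i,i)) < 1"
        by (auto simp: eventually_at_top_linorder)
      have "exp (Re (J $$ (i,i)) * max T 0) < 1"
        using T[of "max T 0"] i by (simp add: norm_jordan_exp)
      with r show False by (simp add: mult_less_0_iff)
    qed
  next
    fix i k assume R: ?R and ik: "i < dim_row J" "k < dim_row J"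
    let ?r = "Re (J $$ (i,i))" and ?c = "norm (\<Prod>l=i..<k. J $$ (l, Suc l))"
    have r: "?r / 2 < 0" using R ik by simp
    show "((\<lambda>t. jordan_exp J t $$ (i,k)) \<longlongrightarrow> 0) at_top"
    proof (cases "i \<le> k")
      case False
      then show ?thesis using ik by (simp add: jordan_exp_def)
    next
      case True
      have "norm (jordan_exp J t $$ (i,k)) \<le> ?c * (1 / - (?r / 2)) ^ (k - i) * exp (?r / 2 * t)" if "t \<ge> 0" for t
      proof -
        have "norm (jordan_exp J t $$ (i,k)) = ?c * ((t ^ (k - i) / fact (k - i) * exp (?r / 2 * t)) * exp (?r / 2 * t))"
          using True ik that by (simp add: norm_jordan_exp mult.assoc exp_add[symmetric])
        also have "\<dots> \<le> ?c * ((1 / - (?r / 2)) ^ (k - i) * exp (?r / 2 * t))"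
          using r that by (intro mult_left_mono mult_right_mono power_fact_exp_bound) auto
        finally show ?thesis by (simp only: mult.assoc)
      qed
      then have le: "\<forall>\<^sub>F t in at_top. norm (jordan_exp J t $$ (i,k)) \<le> ?c * (1 / - (?r / 2)) ^ (k - i) * exp (?r / 2 * t)"
        by (auto simp: eventually_at_top_linorder)
      have "((\<lambda>t. ?c * (1 / - (?r / 2)) ^ (k - i) * exp (?r / 2 * t)) \<longlongrightarrow> 0) at_top"
        by (rule tendsto_mult_right_zero[OF exp_mult_tendsto_zero[OF r]])
      from tendsto_sandwich[OF _ le tendsto_const this]
      have "((\<lambda>t. norm (jordan_exp J t $$ (i,k))) \<longlongrightarrow> 0) at_top"
        by simp
      then show ?thesis by (rule tendsto_norm_zero_cancel)
    qed
  qed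
  finally show ?thesis .
qed

section \<open>The flow of a linear system\<close>

text \<open>
  The mean value theorem is applied to the four real components.
\<close>

lemma zero_derivative_constant:
  fixes g :: "real \<Rightarrow> quat"
  assumes der: "\<And>t. t \<ge> t0 \<Longrightarrow> (g has_vector_derivative 0) (at t within {t0..})" and t: "t \<ge> t0"
  shows "g t = g t0"
proof -
  have bl: "bounded_linear q_re" "bounded_linear q_i" "bounded_linear q_j" "bounded_linear q_k"
    by (auto intro!: bounded_linear_intro[where K = 1] real_le_rsqrt simp: norm_quat_def)
  have "p (g t) = p (g t0)" if p: "bounded_linear p" for p :: "quat \<Rightarrow> real"
  proof (cases "t = t0")
    case False
    with t have lt: "t0 < t" by simp
    have d: "((\<lambda>s. p (g s)) has_real_derivative 0) (at s within {t0..})" if "s \<ge> t0" for s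
      using bounded_linear.has_vector_derivative[OF p der[OF that]] linear_0[OF bounded_linear.linear[OF p]]
      by (simp add: has_real_derivative_iff_has_vector_derivative)
    have cont: "continuous_on {t0..t} (\<lambda>s. p (g s))"
      by (rule DERIV_continuous_on[where D = "\<lambda>_. 0"]) (auto intro: has_field_derivative_subset[OF d])
    show ?thesis
    proof (rule DERIV_isconst2[OF lt cont])
      fix s assume "t0 < s" "s < t"
      then have "at s within {t0..} = at s"
        by (intro at_within_nhd[of _ "{t0<..}" _ UNIV, simplified]) auto
      then show "DERIV (\<lambda>s. p (g s)) s :> 0"
        using d[of s] \<open>t0 < s\<close> by simp
    qed (use lt in auto)
  qed simp
  then show ?thesis using bl by (simp add: quat_eq_iff)
qed

text \<open>
  The function $e^{-dt} f(t)$ has derivative zero.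
\<close>

lemma scalar_homogeneous_solution_zero:
  fixes f :: "real \<Rightarrow> quat"
  assumes f0: "f t0 = 0" and t: "t \<ge> t0"
    and der: "\<And>t. t \<ge> t0 \<Longrightarrow> (f has_vector_derivative quat_of_complex d * f t) (at t within {t0..})"
  shows "f t = 0"
proof -
  let ?E = "\<lambda>t. quat_of_complex (exp (- d * of_real t))"
  have "((\<lambda>t. ?E t * f t) has_vector_derivative 0) (at t within {t0..})" if "t \<ge> t0" for t
  proof -
    have "((\<lambda>z. exp (- d * z)) has_field_derivative exp (- d * of_real t) * - d) (at (of_real t))"
      by (auto intro!: derivative_eq_intros)
    from bounded_linear.has_vector_derivative[OF bounded_linear_quat_of_complex has_vector_derivative_real_field[OF this]]
    have "(?E has_vector_derivative quat_of_complex (exp (- d * of_real t) * - d)) (at t within {t0..})" .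
    from has_vector_derivative_mult[OF this der[OF that]]
    have "((\<lambda>t. ?E t * f t) has_vector_derivative
       ?E t * (quat_of_complex d * f t) + quat_of_complex (exp (- d * of_real t) * - d) * f t) (at t within {t0..})" .
    also have "quat_of_complex (exp (- d * of_real t) * - d) = - (?E t * quat_of_complex d)"
      by (simp add: quat_eq_iff)
    finally show ?thesis by (simp add: mult.assoc)
  qed
  then have "?E t * f t = ?E t0 * f t0"
    by (intro zero_derivative_constant t)
  then have "?E t * f t = 0" by (simp add: f0)
  moreover have "?E t \<noteq> 0"
    using quat_of_complex_eq_iff[of "exp (- d * of_real t)" 0] by simp
  ultimately show ?thesis by simp
qed

lemma mult_mat3_index:
  assumes "P \<in> carrier_mat n n" "X \<in> carrier_mat n n" "Q \<in> carrier_mat n n" "i < n" "k < n"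
  shows "(P * X * Q) $$ (i,k) = (\<Sum>b<n. \<Sum>a<n. P $$ (i,a) * X $$ (a,b) * Q $$ (b,k))"
  using assms by (simp add: scalar_prod_def atLeast0LessThan sum_distrib_right del: assoc_mult_mat)

text \<open>
  A matrix with a fixed reduction $A = P J P^{-1}$, where \<open>Q\<close> is the inverse of \<open>P\<close>. In this locale
  \<open>core t\<close> is $e^{tJ}$ and \<open>fundamental t\<close> is $e^{tA}$.
\<close>

locale jordan_decomposition =
  fixes n :: nat and A :: "quat mat" and J :: "complex mat" and P Q :: "quat mat"
  assumes carrier: "A \<in> carrier_mat n n" "J \<in> carrier_mat n n" "P \<in> carrier_mat n n" "Q \<in> carrier_mat n n"
    and inverse: "P * Q = 1\<^sub>m n" "Q * P = 1\<^sub>m n"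
    and decomposition: "A = P * map_mat quat_of_complex J * Q"
    and bidiagonal: "jordan_bidiagonal J"
begin

abbreviation qJ :: "quat mat" where
  "qJ \<equiv> map_mat quat_of_complex J"

definition core :: "real \<Rightarrow> quat mat" where
  "core t = map_mat quat_of_complex (jordan_exp J t)"

definition fundamental :: "real \<Rightarrow> quat mat" where
  "fundamental t = P * core t * Q"

lemma mult_closed [simp, intro]: "X \<in> carrier_mat n n \<Longrightarrow> Y \<in> carrier_mat n n \<Longrightarrow> X * Y \<in> carrier_mat n n"
  by simp

lemma mult_vec_closed [simp, intro]:
  "X \<in> carrier_mat n n \<Longrightarrow> v \<in> carrier_vec n \<Longrightarrow> X *\<^sub>v v \<in> carrier_vec n"
  by simp

lemma core_carrier [simp, intro]: "core t \<in> carrier_mat n n"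
  using carrier jordan_exp_carrier[of J t] by (auto simp: core_def)

lemma core_dim [simp]: "dim_row (core t) = n" "dim_col (core t) = n"
  by (rule carrier_matD[OF core_carrier])+

lemma fundamental_carrier [simp, intro]: "fundamental t \<in> carrier_mat n n"
  using carrier core_carrier[of t] unfolding fundamental_def by simp

lemma fundamental_dim [simp]: "dim_row (fundamental t) = n" "dim_col (fundamental t) = n"
  by (rule carrier_matD[OF fundamental_carrier])+

lemma Q_P_cancel: "X \<in> carrier_mat n n \<Longrightarrow> Q * (P * X) = X"
  using carrier inverse by (simp add: assoc_mult_mat[symmetric, of Q n n P n X n])

lemma A_mult_P: "A * P = P * qJ"
proof -
  have "A * P = P * qJ * (Q * P)"
    unfolding decomposition using carrier by (intro assoc_mult_mat) auto
  then show ?thesis using carrier inverse by simp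
qed

lemma Q_mult_A: "Q * A = qJ * Q"
proof -
  have "A = P * (qJ * Q)"
    unfolding decomposition using carrier by (intro assoc_mult_mat) auto
  then show ?thesis using Q_P_cancel[of "qJ * Q"] carrier by simp
qed

lemma core_eq: "core t = Q * fundamental t * P"
proof -
  have "fundamental t = P * (core t * Q)"
    unfolding fundamental_def using carrier by (intro assoc_mult_mat) auto
  then have "Q * fundamental t = core t * Q"
    using Q_P_cancel[of "core t * Q"] carrier by simp
  then have "Q * fundamental t * P = core t * Q * P"
    by (rule arg_cong)
  also have "\<dots> = core t * (Q * P)"
    using carrier by (intro assoc_mult_mat) auto
  also have "\<dots> = core t"
    using inverse core_carrier[of t] by simp
  finally show ?thesis by simp
qed

lemma core_zero: "core 0 = 1\<^sub>m n"
  using carrier by (simp add: core_def jordan_exp_zero qc.mat_hom_one)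

lemma fundamental_zero: "fundamental 0 = 1\<^sub>m n"
  using carrier inverse by (simp add: fundamental_def core_zero)

lemma core_has_derivative:
  assumes "i < n" "k < n"
  shows "((\<lambda>t. core (t - t0) $$ (i,k)) has_vector_derivative (qJ * core (t - t0)) $$ (i,k)) (at t within S)"
proof -
  have dim: "dim_row J = n" using carrier by simp
  have "(qJ * core (t - t0)) $$ (i,k) = (qJ *\<^sub>v col (core (t - t0)) k) $ i"
    using carrier assms by simp
  also have "\<dots> = quat_of_complex (J $$ (i,i) * jordan_exp J (t - t0) $$ (i,k) +
      (if Suc i < dim_row J then J $$ (i, Suc i) * jordan_exp J (t - t0) $$ (Suc i,k) else 0))"
    using assms dim core_carrier[of "t - t0"] jordan_exp_carrier[of J "t - t0"]
    by (subst jordan_bidiagonal_mult_vec_index[OF bidiagonal])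
      (auto simp: core_def qc.hom_add qc.hom_mult dim)
  finally have eq: "(qJ * core (t - t0)) $$ (i,k) = \<dots>" .
  have entry: "core (s - t0) $$ (i,k) = quat_of_complex (jordan_exp J (s - t0) $$ (i,k))" for s
    using assms dim jordan_exp_carrier[of J "s - t0"] by (simp add: core_def)
  show ?thesis
    unfolding eq entry using assms dim
    by (intro bounded_linear.has_vector_derivative[OF bounded_linear_quat_of_complex]
        jordan_exp_has_derivative[OF bidiagonal]) auto
qed

lemma fundamental_has_derivative:
  assumes "i < n" "k < n"
  shows "((\<lambda>t. fundamental (t - t0) $$ (i,k)) has_vector_derivative (A * fundamental (t - t0)) $$ (i,k)) (at t within S)"
proof -
  have "A * fundamental (t - t0) = A * (P * core (t - t0)) * Q"
    unfolding fundamental_def using carrier by (intro assoc_mult_mat[symmetric]) auto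
  also have "A * (P * core (t - t0)) = A * P * core (t - t0)"
    using carrier by (intro assoc_mult_mat[symmetric]) auto
  also have "\<dots> = P * (qJ * core (t - t0))"
    unfolding A_mult_P using carrier by (intro assoc_mult_mat) auto
  finally have "(A * fundamental (t - t0)) $$ (i,k)
      = (\<Sum>b<n. \<Sum>a<n. P $$ (i,a) * (qJ * core (t - t0)) $$ (a,b) * Q $$ (b,k))"
    using mult_mat3_index[of P n "qJ * core (t - t0)" Q i k] carrier assms by simp
  moreover have "fundamental (s - t0) $$ (i,k) = (\<Sum>b<n. \<Sum>a<n. P $$ (i,a) * core (s - t0) $$ (a,b) * Q $$ (b,k))" for s
    unfolding fundamental_def using mult_mat3_index[of P n "core (s - t0)" Q i k] carrier assms by simp
  moreover have "((\<lambda>s. \<Sum>b<n. \<Sum>a<n. P $$ (i,a) * core (s - t0) $$ (a,b) * Q $$ (b,k)) has_vector_derivative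
     (\<Sum>b<n. \<Sum>a<n. P $$ (i,a) * (qJ * core (t - t0)) $$ (a,b) * Q $$ (b,k))) (at t within S)"
    by (intro has_vector_derivative_sum
        bounded_linear.has_vector_derivative[OF bounded_linear_mult_left]
        bounded_linear.has_vector_derivative[OF bounded_linear_mult_right] core_has_derivative) auto
  ultimately show ?thesis by simp
qed

lemma mult_vec_sum: "M \<in> carrier_mat n n \<Longrightarrow> v \<in> carrier_vec n \<Longrightarrow> i < n \<Longrightarrow>
    (M *\<^sub>v v) $ i = (\<Sum>k<n. M $$ (i,k) * v $ k)"
  by (auto simp: scalar_prod_def atLeast0LessThan)

lemma fundamental_solution:
  assumes x0: "x0 \<in> carrier_vec n"
  shows "is_solution (\<lambda>t x. A *\<^sub>v x) t0 x0 (\<lambda>t. fundamental (t - t0) *\<^sub>v x0)"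
  unfolding is_solution_def
proof (intro conjI allI impI)
  show "fundamental (t0 - t0) *\<^sub>v x0 = x0"
    using x0 by (simp add: fundamental_zero)
  fix t
  show "fundamental (t - t0) *\<^sub>v x0 \<in> carrier_vec (dim_vec x0)"
    using x0 fundamental_carrier[of "t - t0"] by simp
  fix k assume "k < dim_vec x0"
  then have k: "k < n" using x0 by simp
  have "(A *\<^sub>v (fundamental (t - t0) *\<^sub>v x0)) $ k = (A * fundamental (t - t0) *\<^sub>v x0) $ k"
    using carrier x0 by (simp add: assoc_mult_mat_vec[of A n n _ n])
  also have "\<dots> = (\<Sum>l<n. (A * fundamental (t - t0)) $$ (k,l) * x0 $ l)"
    using carrier x0 k by (intro mult_vec_sum) auto
  finally have *: "(A *\<^sub>v (fundamental (t - t0) *\<^sub>v x0)) $ k = \<dots>" .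
  have **: "(fundamental (s - t0) *\<^sub>v x0) $ k = (\<Sum>l<n. fundamental (s - t0) $$ (k,l) * x0 $ l)" for s
    using x0 k by (intro mult_vec_sum) auto
  show "((\<lambda>s. (fundamental (s - t0) *\<^sub>v x0) $ k) has_vector_derivative (A *\<^sub>v (fundamental (t - t0) *\<^sub>v x0)) $ k)
      (at t within {t0..})"
    unfolding * ** using k
    by (intro has_vector_derivative_sum
        bounded_linear.has_vector_derivative[OF bounded_linear_mult_left] fundamental_has_derivative) auto
qed

text \<open>
  The difference \<open>z\<close> of two solutions, in the coordinates \<open>y = Q z\<close>, solves the triangular system
  with matrix \<open>J\<close>. Its last component satisfies a scalar homogeneous equation and starts at zero,
  hence vanishes; then the same holds for the component before it, and so on.
\<close>

lemma solution_unique: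
  assumes x: "is_solution (\<lambda>t x. A *\<^sub>v x) t0 x0 x" and x': "is_solution (\<lambda>t x. A *\<^sub>v x) t0 x0 x'"
    and x0: "x0 \<in> carrier_vec n" and t: "t \<ge> t0"
  shows "x t = x' t"
proof -
  have xc: "x s \<in> carrier_vec n" "x' s \<in> carrier_vec n" if "s \<ge> t0" for s
    using x x' x0 that by (auto simp: is_solution_def)
  have xd: "((\<lambda>s. x s $ k) has_vector_derivative (A *\<^sub>v x s) $ k) (at s within {t0..})"
    "((\<lambda>s. x' s $ k) has_vector_derivative (A *\<^sub>v x' s) $ k) (at s within {t0..})" if "s \<ge> t0" "k < n" for s k
    using x x' x0 that by (auto simp: is_solution_def)
  define z where "z s = vec n (\<lambda>k. x s $ k - x' s $ k)" for s
  have zc: "z s \<in> carrier_vec n" for s by (simp add: z_def)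
  have z_eq: "z s = x s - x' s" if "s \<ge> t0" for s
    using xc[OF that] by (intro eq_vecI) (auto simp: z_def)
  have zd: "((\<lambda>s. z s $ k) has_vector_derivative (A *\<^sub>v z s) $ k) (at s within {t0..})" if "s \<ge> t0" "k < n" for s k
  proof -
    have "(A *\<^sub>v z s) $ k = (A *\<^sub>v x s) $ k - (A *\<^sub>v x' s) $ k"
      unfolding z_eq[OF that(1)] using xc[OF that(1)] carrier that(2)
      by (simp add: mult_minus_distrib_mat_vec[of A n n])
    moreover have "(\<lambda>s. z s $ k) = (\<lambda>s. x s $ k - x' s $ k)"
      using that by (simp add: z_def)
    ultimately show ?thesis
      using has_vector_derivative_diff[OF xd[OF that]] by simp
  qed
  define y where "y s = Q *\<^sub>v z s" for s
  have yc: "y s \<in> carrier_vec n" for s using carrier zc by (simp add: y_def)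
  have y0: "y t0 $ i = 0" if "i < n" for i
  proof -
    have "z t0 = 0\<^sub>v n"
      using x x' by (intro eq_vecI) (auto simp: z_def is_solution_def)
    then show ?thesis using carrier that by (simp add: y_def)
  qed
  have yd: "((\<lambda>s. y s $ i) has_vector_derivative (qJ *\<^sub>v y s) $ i) (at s within {t0..})" if "s \<ge> t0" "i < n" for s i
  proof -
    have "qJ *\<^sub>v y s = qJ * Q *\<^sub>v z s"
      unfolding y_def using carrier zc by (intro assoc_mult_mat_vec[symmetric]) auto
    also have "\<dots> = Q *\<^sub>v (A *\<^sub>v z s)"
      unfolding Q_mult_A[symmetric] using carrier zc by (intro assoc_mult_mat_vec) auto
    finally have "(qJ *\<^sub>v y s) $ i = (\<Sum>k<n. Q $$ (i,k) * (A *\<^sub>v z s) $ k)"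
      using mult_vec_sum[of Q "A *\<^sub>v z s" i] carrier zc that by simp
    moreover have "(\<lambda>s. y s $ i) = (\<lambda>s. \<Sum>k<n. Q $$ (i,k) * z s $ k)"
      unfolding y_def using mult_vec_sum[of Q _ i] carrier zc that by simp
    ultimately show ?thesis
      using that by (auto intro!: has_vector_derivative_sum
          bounded_linear.has_vector_derivative[OF bounded_linear_mult_right] zd)
  qed
  have dim: "dim_row J = n" using carrier by simp
  have y_zero: "y s $ i = 0" if "i < n" "s \<ge> t0" for i s
    using that
  proof (induction "n - i" arbitrary: i s rule: less_induct)
    case less
    have "(qJ *\<^sub>v y s) $ i = quat_of_complex (J $$ (i,i)) * y s $ i" if "s \<ge> t0" for s
      using jordan_bidiagonal_mult_vec_index[OF bidiagonal, of "y s" i] less.hyps[of "Suc i" s] less.prems(1) that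
      by (auto simp: dim yc split: if_splits)
    then show ?case
      using scalar_homogeneous_solution_zero[of "\<lambda>s. y s $ i" t0 s "J $$ (i,i)"] yd[OF _ less.prems(1)]
        y0 less.prems by simp
  qed
  have "z t = P *\<^sub>v y t"
    unfolding y_def using carrier zc inverse by (simp add: assoc_mult_mat_vec[symmetric, of P n n Q n])
  also have "y t = 0\<^sub>v n"
    using yc[of t] y_zero t by (intro eq_vecI) auto
  also have "P *\<^sub>v 0\<^sub>v n = 0\<^sub>v n"
    using carrier by (intro eq_vecI) auto
  finally have z0: "z t = 0\<^sub>v n" .
  show ?thesis
  proof (rule eq_vecI)
    fix i assume "i < dim_vec (x' t)"
    then have i: "i < n" using xc[OF t] by simp
    have "z t $ i = 0" using z0 i by simp
    then show "x t $ i = x' t $ i" using i by (simp add: z_def)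
  qed (use xc[OF t] in simp)
qed

lemma flow_eq:
  assumes x0: "x0 \<in> carrier_vec n" and t: "t \<ge> t0"
  shows "flow (\<lambda>t x. A *\<^sub>v x) t t0 x0 = fundamental (t - t0) *\<^sub>v x0"
proof -
  let ?x = "SOME x. is_solution (\<lambda>t x. A *\<^sub>v x) t0 x0 x"
  have "is_solution (\<lambda>t x. A *\<^sub>v x) t0 x0 ?x"
    by (rule someI[of "is_solution (\<lambda>t x. A *\<^sub>v x) t0 x0", OF fundamental_solution[OF x0]])
  from solution_unique[OF this fundamental_solution[OF x0] x0 t]
  show ?thesis by (simp add: flow_def)
qed

end

section \<open>Stability of linear systems\<close>

text \<open>
  Boundedness and convergence to zero are both inherited by linear combinations with constant
  coefficients, which is all that passing between $e^{tJ}$ and $e^{tA}$ needs. The predicate \<open>R\<close> covers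
  both.
\<close>

lemma entries_mult_mat3:
  fixes X :: "real \<Rightarrow> quat mat"
  assumes R0: "R (\<lambda>_. 0)" and R_add: "\<And>f g. R f \<Longrightarrow> R g \<Longrightarrow> R (\<lambda>t. f t + g t)"
    and R_mult: "\<And>f p q. R f \<Longrightarrow> R (\<lambda>t. p * f t * q)"
    and carr: "P \<in> carrier_mat n n" "\<And>t. X t \<in> carrier_mat n n" "Q \<in> carrier_mat n n"
    and X: "\<And>i k. i < n \<Longrightarrow> k < n \<Longrightarrow> R (\<lambda>t. X t $$ (i,k))"
    and ik: "i < n" "k < n"
  shows "R (\<lambda>t. (P * X t * Q) $$ (i,k))"
proof -
  have R_sum: "R (\<lambda>t. \<Sum>a\<in>S. f a t)" if "finite S" "\<And>a. a \<in> S \<Longrightarrow> R (f a)" for f :: "nat \<Rightarrow> real \<Rightarrow> quat" and S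
    using that by (induction S) (simp_all add: R0 R_add)
  show ?thesis
    unfolding mult_mat3_index[OF carr(1) carr(2) carr(3) ik]
    using X ik by (intro R_sum R_mult) auto
qed

lemma bounded_after_closure:
  fixes f g :: "real \<Rightarrow> quat"
  shows "bounded_after t0 (\<lambda>_. 0 :: quat)"
    and "bounded_after t0 f \<Longrightarrow> bounded_after t0 g \<Longrightarrow> bounded_after t0 (\<lambda>t. f t + g t)"
    and "bounded_after t0 f \<Longrightarrow> bounded_after t0 (\<lambda>t. p * f t * q)"
proof -
  show "bounded_after t0 (\<lambda>_. 0 :: quat)"
    by (auto simp: bounded_after_def)
  show "bounded_after t0 (\<lambda>t. f t + g t)" if f: "bounded_after t0 f" and g: "bounded_after t0 g"
  proof -
    obtain C D where "\<And>t. t \<ge> t0 \<Longrightarrow> norm (f t) \<le> C" "\<And>t. t \<ge> t0 \<Longrightarrow> norm (g t) \<le> D"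
      using f g unfolding bounded_after_def by blast
    then show ?thesis
      unfolding bounded_after_def by (intro exI[of _ "C + D"]) (auto intro: norm_triangle_le add_mono)
  qed
  show "bounded_after t0 (\<lambda>t. p * f t * q)" if f: "bounded_after t0 f"
  proof -
    obtain C where C: "\<And>t. t \<ge> t0 \<Longrightarrow> norm (f t) \<le> C"
      using f unfolding bounded_after_def by blast
    show ?thesis
      unfolding bounded_after_def norm_mult
      by (intro exI[of _ "norm p * C * norm q"] allI impI mult_right_mono mult_left_mono C) auto
  qed
qed

lemma norm_le_qvec_norm:
  "i < dim_vec v \<Longrightarrow> norm (v $ i) \<le> qvec_norm v"
  unfolding qvec_norm_def by (rule member_le_sum) auto

context jordan_decomposition
begin

lemma qvec_norm_mult_le:
  assumes M: "M \<in> carrier_mat n n" and v: "v \<in> carrier_vec n"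
  shows "qvec_norm (M *\<^sub>v v) \<le> (\<Sum>i<n. \<Sum>k<n. norm (M $$ (i,k))) * qvec_norm v"
proof -
  have "qvec_norm (M *\<^sub>v v) = (\<Sum>i<n. norm (\<Sum>k<n. M $$ (i,k) * v $ k))"
    unfolding qvec_norm_def using M v by (intro sum.cong) (auto simp: mult_vec_sum simp del: index_mult_mat_vec)
  also have "\<dots> \<le> (\<Sum>i<n. \<Sum>k<n. norm (M $$ (i,k)) * qvec_norm v)"
    using v by (intro sum_mono order_trans[OF norm_sum])
      (auto simp: norm_mult intro!: mult_left_mono norm_le_qvec_norm)
  finally show ?thesis by (simp add: sum_distrib_right)
qed

lemma flow_difference:
  assumes "x \<in> carrier_vec n" "t \<ge> t0"
  shows "flow (\<lambda>t x. A *\<^sub>v x) t t0 x - flow (\<lambda>t x. A *\<^sub>v x) t t0 (0\<^sub>v n) = fundamental (t - t0) *\<^sub>v x"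
proof -
  have "fundamental (t - t0) *\<^sub>v 0\<^sub>v n = 0\<^sub>v n"
    by (intro eq_vecI) (auto simp: mult_vec_sum simp del: index_mult_mat_vec)
  then show ?thesis
    using assms by (simp add: flow_eq)
qed

text \<open>
  Stability only speaks about small initial values. A small multiple of the \<open>k\<close>-th unit vector is
  such a value, and its trajectory is that multiple of the \<open>k\<close>-th column of $e^{tA}$.
\<close>

lemma probe_column:
  assumes "i < n" "k < n" "0 < \<delta>"
  defines "x \<equiv> vec n (\<lambda>l. if l = k then (\<delta> / 2) *\<^sub>R 1 else 0 :: quat)"
  shows "x \<in> carrier_vec n" "qvec_norm x < \<delta>"
    "norm (fundamental t $$ (i,k)) \<le> qvec_norm (fundamental t *\<^sub>v x) * (2 / \<delta>)"
proof -
  show x: "x \<in> carrier_vec n" by (simp add: x_def)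
  have "qvec_norm x = (\<Sum>l<n. if l = k then \<delta> / 2 else 0)"
    unfolding qvec_norm_def x_def using assms(3) by (intro sum.cong) auto
  then show "qvec_norm x < \<delta>" using assms by simp
  have "(fundamental t *\<^sub>v x) $ i = (\<Sum>l<n. if l = k then fundamental t $$ (i,k) * (\<delta> / 2) *\<^sub>R 1 else 0)"
    using assms(1) x unfolding mult_vec_sum[OF fundamental_carrier x assms(1)]
    by (intro sum.cong) (auto simp: x_def)
  also have "\<dots> = fundamental t $$ (i,k) * (\<delta> / 2) *\<^sub>R 1"
    using assms by simp
  finally have "norm (fundamental t $$ (i,k)) * (\<delta> / 2) = norm ((fundamental t *\<^sub>v x) $ i)"
    using assms(3) by simp
  also have "\<dots> \<le> qvec_norm (fundamental t *\<^sub>v x)"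
    using assms(1) by (intro norm_le_qvec_norm) simp
  finally show "norm (fundamental t $$ (i,k)) \<le> qvec_norm (fundamental t *\<^sub>v x) * (2 / \<delta>)"
    using assms(3) by (simp add: field_simps)
qed

lemma stable_iff_fundamental_bounded:
  "linear_system_stable A t0 \<longleftrightarrow> (\<forall>i<n. \<forall>k<n. bounded_after t0 (\<lambda>t. fundamental (t - t0) $$ (i,k)))"
proof -
  have dim: "dim_row A = n" using carrier by simp
  have "linear_system_stable A t0 \<longleftrightarrow> (\<forall>\<epsilon>>0. \<exists>\<delta>>0. \<forall>x\<in>carrier_vec n. qvec_norm x < \<delta> \<longrightarrow>
      (\<forall>t\<ge>t0. qvec_norm (fundamental (t - t0) *\<^sub>v x) < \<epsilon>))"
    unfolding linear_system_stable_def stable_solution_def dim by (simp add: flow_difference cong: ball_cong)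
  also have "\<dots> \<longleftrightarrow> (\<forall>i<n. \<forall>k<n. bounded_after t0 (\<lambda>t. fundamental (t - t0) $$ (i,k)))" (is "?L \<longleftrightarrow> ?R")
  proof
    assume ?L
    then have "0 < (1 :: real) \<longrightarrow> (\<exists>\<delta>>0. \<forall>x\<in>carrier_vec n. qvec_norm x < \<delta> \<longrightarrow>
        (\<forall>t\<ge>t0. qvec_norm (fundamental (t - t0) *\<^sub>v x) < 1))"
      by (rule spec)
    then obtain \<delta> where \<delta>: "\<delta> > 0" "\<And>x t. x \<in> carrier_vec n \<Longrightarrow> qvec_norm x < \<delta> \<Longrightarrow> t \<ge> t0 \<Longrightarrow>
        qvec_norm (fundamental (t - t0) *\<^sub>v x) < 1"
      by auto
    show ?R
    proof (intro allI impI)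
      fix i k assume ik: "i < n" "k < n"
      note probe = probe_column[OF ik \<delta>(1)]
      have "norm (fundamental (t - t0) $$ (i,k)) \<le> 1 * (2 / \<delta>)" if "t \<ge> t0" for t
        using \<delta>(1) by (intro order_trans[OF probe(3)] mult_right_mono less_imp_le[OF \<delta>(2)[OF probe(1,2) that]]) auto
      then show "bounded_after t0 (\<lambda>t. fundamental (t - t0) $$ (i,k))"
        unfolding bounded_after_def by blast
    qed
  next
    assume ?R
    then have "\<forall>i k. \<exists>C. i < n \<longrightarrow> k < n \<longrightarrow> (\<forall>t\<ge>t0. norm (fundamental (t - t0) $$ (i,k)) \<le> C)"
      unfolding bounded_after_def by blast
    then obtain C where C: "\<And>i k t. i < n \<Longrightarrow> k < n \<Longrightarrow> t \<ge> t0 \<Longrightarrow> norm (fundamental (t - t0) $$ (i,k)) \<le> C i k"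
      by metis
    define K where "K = \<bar>\<Sum>i<n. \<Sum>k<n. C i k\<bar> + 1"
    have K: "K > 0" by (simp add: K_def)
    have le: "qvec_norm (fundamental (t - t0) *\<^sub>v x) \<le> K * qvec_norm x" if "x \<in> carrier_vec n" "t \<ge> t0" for x t
    proof -
      have "(\<Sum>i<n. \<Sum>k<n. norm (fundamental (t - t0) $$ (i,k))) \<le> (\<Sum>i<n. \<Sum>k<n. C i k)"
        using that by (intro sum_mono C) auto
      also have "\<dots> \<le> K" by (simp add: K_def)
      finally show ?thesis
        by (intro order_trans[OF qvec_norm_mult_le[OF fundamental_carrier that(1)]] mult_right_mono)
          (simp_all add: qvec_norm_def sum_nonneg)
    qed
    show ?L
    proof (intro allI impI)
      fix \<epsilon> :: real assume \<epsilon>: "\<epsilon> > 0"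
      show "\<exists>\<delta>>0. \<forall>x\<in>carrier_vec n. qvec_norm x < \<delta> \<longrightarrow> (\<forall>t\<ge>t0. qvec_norm (fundamental (t - t0) *\<^sub>v x) < \<epsilon>)"
      proof (intro exI[of _ "\<epsilon> / K"] conjI ballI impI allI)
        fix x t assume "x \<in> carrier_vec n" "t \<ge> t0" and small: "qvec_norm x < \<epsilon> / K"
        then have "qvec_norm (fundamental (t - t0) *\<^sub>v x) \<le> K * qvec_norm x" by (intro le)
        also have "\<dots> < \<epsilon>" using small K by (simp add: field_simps)
        finally show "qvec_norm (fundamental (t - t0) *\<^sub>v x) < \<epsilon>" .
      qed (use \<epsilon> K in simp)
    qed
  qed
  finally show ?thesis .
qed

lemma asymptotically_stable_iff_fundamental_tendsto_zero:
  "linear_system_asymptotically_stable A t0 \<longleftrightarrow>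
    (\<forall>i<n. \<forall>k<n. ((\<lambda>t. fundamental (t - t0) $$ (i,k)) \<longlongrightarrow> 0) at_top)"
proof -
  have dim: "dim_row A = n" using carrier by simp
  have ev: "\<forall>\<^sub>F t in at_top. qvec_norm (flow (\<lambda>t x. A *\<^sub>v x) t t0 x - flow (\<lambda>t x. A *\<^sub>v x) t t0 (0\<^sub>v n))
      = qvec_norm (fundamental (t - t0) *\<^sub>v x)" if "x \<in> carrier_vec n" for x
    using eventually_ge_at_top[of t0] by eventually_elim (simp add: flow_difference that)
  have "linear_system_asymptotically_stable A t0 \<longleftrightarrow> (\<exists>\<delta>>0. \<forall>x\<in>carrier_vec n. qvec_norm x < \<delta> \<longrightarrow>
      ((\<lambda>t. qvec_norm (fundamental (t - t0) *\<^sub>v x)) \<longlongrightarrow> 0) at_top)"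
    unfolding linear_system_asymptotically_stable_def asymptotically_stable_solution_def dim
    by (simp add: tendsto_cong[OF ev] cong: ball_cong)
  also have "\<dots> \<longleftrightarrow> (\<forall>i<n. \<forall>k<n. ((\<lambda>t. fundamental (t - t0) $$ (i,k)) \<longlongrightarrow> 0) at_top)" (is "?L \<longleftrightarrow> ?R")
  proof
    assume ?L
    then obtain \<delta> where \<delta>: "\<delta> > 0" "\<And>x. x \<in> carrier_vec n \<Longrightarrow> qvec_norm x < \<delta> \<Longrightarrow>
        ((\<lambda>t. qvec_norm (fundamental (t - t0) *\<^sub>v x)) \<longlongrightarrow> 0) at_top"
      by blast
    show ?R
    proof (intro allI impI)
      fix i k assume ik: "i < n" "k < n"
      note probe = probe_column[OF ik \<delta>(1)]
      have "((\<lambda>t. norm (fundamental (t - t0) $$ (i,k))) \<longlongrightarrow> 0) at_top"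
        by (rule tendsto_sandwich[OF _ _ tendsto_const tendsto_mult_left_zero[OF \<delta>(2)[OF probe(1,2)], of "2 / \<delta>"]])
          (simp, intro always_eventually allI probe(3))
      then show "((\<lambda>t. fundamental (t - t0) $$ (i,k)) \<longlongrightarrow> 0) at_top"
        by (rule tendsto_norm_zero_cancel)
    qed
  next
    assume R: ?R
    have "((\<lambda>t. qvec_norm (fundamental (t - t0) *\<^sub>v x)) \<longlongrightarrow> 0) at_top" if x: "x \<in> carrier_vec n" for x
    proof -
      have "((\<lambda>t. (\<Sum>i<n. \<Sum>k<n. norm (fundamental (t - t0) $$ (i,k))) * qvec_norm x) \<longlongrightarrow> 0) at_top"
        using R by (intro tendsto_mult_left_zero tendsto_null_sum tendsto_norm_zero) auto
      from tendsto_sandwich[OF _ _ tendsto_const this] show ?thesis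
        using qvec_norm_mult_le[OF fundamental_carrier x] by (simp add: qvec_norm_def sum_nonneg)
    qed
    then show ?L by (intro exI[of _ 1]) auto
  qed
  finally show ?thesis .
qed

lemma entries_core_iff_fundamental:
  assumes "R (\<lambda>_. 0 :: quat)" "\<And>f g. R f \<Longrightarrow> R g \<Longrightarrow> R (\<lambda>t. f t + g t)" "\<And>f p q. R f \<Longrightarrow> R (\<lambda>t. p * f t * q)"
  shows "(\<forall>i<n. \<forall>k<n. R (\<lambda>t. fundamental (t - t0) $$ (i,k))) \<longleftrightarrow> (\<forall>i<n. \<forall>k<n. R (\<lambda>t. core (t - t0) $$ (i,k)))"
proof (intro iffI allI impI)
  fix i k assume R: "\<forall>i<n. \<forall>k<n. R (\<lambda>t. fundamental (t - t0) $$ (i,k))" and ik: "i < n" "k < n"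
  show "R (\<lambda>t. core (t - t0) $$ (i,k))"
    unfolding core_eq using R ik carrier
    by (intro entries_mult_mat3[of R Q n "\<lambda>t. fundamental (t - t0)" P] assms) auto
next
  fix i k assume R: "\<forall>i<n. \<forall>k<n. R (\<lambda>t. core (t - t0) $$ (i,k))" and ik: "i < n" "k < n"
  show "R (\<lambda>t. fundamental (t - t0) $$ (i,k))"
    unfolding fundamental_def using R ik carrier
    by (intro entries_mult_mat3[of R P n "\<lambda>t. core (t - t0)" Q] assms) auto
qed

lemma core_index: "i < n \<Longrightarrow> k < n \<Longrightarrow> core t $$ (i,k) = quat_of_complex (jordan_exp J t $$ (i,k))"
  using carrier jordan_exp_carrier[of J t] by (simp add: core_def)

lemma stable_iff:
  "linear_system_stable A t0 \<longleftrightarrow>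
    (\<forall>i<n. Re (J $$ (i,i)) \<le> 0 \<and> (Re (J $$ (i,i)) = 0 \<longrightarrow> Suc i < n \<longrightarrow> J $$ (i, Suc i) = 0))"
proof -
  have dim: "dim_row J = n" using carrier by simp
  have "linear_system_stable A t0 \<longleftrightarrow> (\<forall>i<n. \<forall>k<n. bounded_after t0 (\<lambda>t. core (t - t0) $$ (i,k)))"
    unfolding stable_iff_fundamental_bounded
    by (rule entries_core_iff_fundamental) (fact bounded_after_closure)+
  also have "\<dots> \<longleftrightarrow> (\<forall>i<n. \<forall>k<n. bounded_after t0 (\<lambda>t. jordan_exp J (t - t0) $$ (i,k)))"
    by (simp add: core_index bounded_after_def)
  finally show ?thesis
    using jordan_exp_bounded_iff[OF bidiagonal, of t0] by (simp add: dim)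
qed

lemma asymptotically_stable_iff:
  "linear_system_asymptotically_stable A t0 \<longleftrightarrow> (\<forall>i<n. Re (J $$ (i,i)) < 0)"
proof -
  have dim: "dim_row J = n" using carrier by simp
  have "linear_system_asymptotically_stable A t0 \<longleftrightarrow> (\<forall>i<n. \<forall>k<n. ((\<lambda>t. core (t - t0) $$ (i,k)) \<longlongrightarrow> 0) at_top)"
    unfolding asymptotically_stable_iff_fundamental_tendsto_zero
    by (rule entries_core_iff_fundamental[where R = "\<lambda>f. (f \<longlongrightarrow> 0) at_top"])
      (auto intro: tendsto_add_zero tendsto_mult_left_zero tendsto_mult_right_zero)
  also have "\<dots> \<longleftrightarrow> (\<forall>i<n. \<forall>k<n. ((\<lambda>t. jordan_exp J (t - t0) $$ (i,k)) \<longlongrightarrow> 0) at_top)"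
  proof -
    have "((\<lambda>t. core (t - t0) $$ (i,k)) \<longlongrightarrow> 0) at_top \<longleftrightarrow> ((\<lambda>t. jordan_exp J (t - t0) $$ (i,k)) \<longlongrightarrow> 0) at_top"
      if "i < n" "k < n" for i k
      using tendsto_norm_zero_iff[of "\<lambda>t. core (t - t0) $$ (i,k)" at_top]
        tendsto_norm_zero_iff[of "\<lambda>t. jordan_exp J (t - t0) $$ (i,k)" at_top] that
      by (simp add: core_index)
    then show ?thesis by blast
  qed
  finally show ?thesis
    using jordan_exp_tendsto_zero_iff[of J t0] by (simp add: dim)
qed

end

theorem theorem3p3:
  fixes A :: "quat mat" and n :: nat and t0 :: real
  assumes "A \<in> carrier_mat n n"
  shows "(linear_system_stable A t0 \<longleftrightarrow>
      (\<forall>\<mu>. standard_eigenvalue A \<mu> \<longrightarrow> Re \<mu> \<le> 0) \<and>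
      (\<forall>\<mu>. standard_eigenvalue A \<mu> \<and> Re \<mu> = 0 \<longrightarrow>
        algebraic_multiplicity A \<mu> = geometric_multiplicity A \<mu>))
    \<and> (linear_system_asymptotically_stable A t0 \<longleftrightarrow>
      (\<forall>\<mu>. standard_eigenvalue A \<mu> \<longrightarrow> Re \<mu> < 0))"
proof -
  define J where "J = jordan_form A"
  have jf: "is_jordan_form A J"
    unfolding J_def by (rule jordan_form[OF assms])
  then have sim: "similar_mat A (map_mat quat_of_complex J)"
    and im: "\<And>i. i < dim_row J \<Longrightarrow> 0 \<le> Im (J $$ (i,i))" and bd: "jordan_bidiagonal J"
    by (auto simp: is_jordan_form_def jordan_bidiagonal_jordan_matrix)
  obtain P Q where PQ: "similar_mat_wit A (map_mat quat_of_complex J) P Q"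
    using sim by (auto simp: similar_mat_def)
  interpret jordan_decomposition n A J P Q
    using similar_mat_witD2[OF assms PQ] bd by unfold_locales auto
  have dim: "dim_row J = n" using carrier by simp
  have ev: "standard_eigenvalue A \<mu> \<longleftrightarrow> (\<exists>i<n. J $$ (i,i) = \<mu>)" for \<mu>
    using standard_eigenvalue_iff_diagonal[OF bd im sim] dim by simp
  show ?thesis
    unfolding stable_iff asymptotically_stable_iff ev multiplicities_eq_iff[OF assms] J_def[symmetric] dim
    by (blast dest: Suc_lessD)
qed

end
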